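(* Let $0\le\beta<1/2$, and set $\overline L:=[|\log p|/\log 2]$, $\overline M:=[Np|\log p|/(\log 2)^2]$. Let $P^{\mathcal R-\mathcal P}_{N,\overline M,\overline L}$ be the probability distribution on $N\times\overline M$ binary matrices $C_{N,\overline M}=(c_{i,a})$ under which the rows are independent and each row is uniformly distributed among the $\binom{\overline M}{\overline L}$ binary vectors with exactly $\overline L$ ones. Then $$\lim_{N\to\infty\vert\beta}\sum_{C_{N,\overline M}}P^{\mathcal R-\mathcal P}_{N,\overline M,\overline L}(C_{N,\overline M})\,\frac{T_{\overline M,C_{N,\overline M},p}}{Np|\log p|}=\frac{1}{(\log 2)^2}.$$
   Context: Probabilistic group testing with two-stage algorithms. For an integer $N\ge1$ and $p\in(0,1)$, a configuration $X=(x_1,\dots,x_N)\in\{0,1\}^N$ is drawn from $\mu_p(X)=\prod_{i} p^{x_i}(1-p)^{1-x_i}$. A first stage with $M$ tests is an $N\times M$ binary matrix $C_{N,M}=(c_{i,a})$; variable $i$ belongs to test $a$ iff $c_{i,a}=1$. Test outcome $T_a=0$ if $c_{i,a}x_i=0$ for all $i$, else $T_a=1$. Variable $i$ is a sure zero if some $a$ has $c_{i,a}=1$ and $T_a=0$; it is a sure one if $x_i=1$ and some $a$ with $c_{i,a}=1$ has every other $j$ with $c_{j,a}=1$ a sure zero. $\mathcal U_0$ is the set of $i$ with $x_i=0$ not sure zeros, $\mathcal U_1$ the set of $i$ with $x_i=1$ not sure ones. $T_{M,C_{N,M},p}:=M+\sum_X\mu_p(X)(|\mathcal U_0|+|\mathcal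 U_1|)$. $[x]$ denotes the integer part, $\log$ the natural logarithm. For $\beta>0$, $\lim_{N\to\infty\vert\beta}f(N,p):=\lim_{N\to\infty}f(N,N^{-\beta})$; for $\beta=0$, $\lim_{N\to\infty\vert 0}f(N,p):=\lim_{p\to0}\lim_{N\to\infty}f(N,p)$. *)

theory Defs
  imports "HOL-Analysis.Analysis"
begin

text \<open>A configuration X in {0,1}^N is represented by the set of indices i < N with x_i = 1.
  A first-stage design C_{N,M} is represented by C :: nat => nat => bool, where C i a means
  c_{i,a} = 1; only entries with i < N and a < M may be true.\<close>

definition configs :: "nat \<Rightarrow> nat set set" where
  "configs N = Pow {..<N}"

definition matrices :: "nat \<Rightarrow> nat \<Rightarrow> (nat \<Rightarrow> nat \<Rightarrow> bool) set" where
  "matrices N M = {C. \<forall>i a. C i a \<longrightarrow> i < N \<and> a < M}"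

definition mu :: "nat \<Rightarrow> real \<Rightarrow> nat set \<Rightarrow> real" where
  "mu N p X = p ^ card X * (1 - p) ^ (N - card X)"

definition test_outcome :: "nat \<Rightarrow> (nat \<Rightarrow> nat \<Rightarrow> bool) \<Rightarrow> nat set \<Rightarrow> nat \<Rightarrow> bool" where
  "test_outcome N C X a = (\<exists>i<N. C i a \<and> i \<in> X)"

definition sure_zero :: "nat \<Rightarrow> nat \<Rightarrow> (nat \<Rightarrow> nat \<Rightarrow> bool) \<Rightarrow> nat set \<Rightarrow> nat \<Rightarrow> bool" where
  "sure_zero N M C X i = (\<exists>a<M. C i a \<and> \<not> test_outcome N C X a)"

definition sure_one :: "nat \<Rightarrow> nat \<Rightarrow> (nat \<Rightarrow> nat \<Rightarrow> bool) \<Rightarrow> nat set \<Rightarrow> nat \<Rightarrow> bool" where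
  "sure_one N M C X i = (i \<in> X \<and>
     (\<exists>a<M. C i a \<and> (\<forall>j<N. j \<noteq> i \<and> C j a \<longrightarrow> sure_zero N M C X j)))"

definition U0 :: "nat \<Rightarrow> nat \<Rightarrow> (nat \<Rightarrow> nat \<Rightarrow> bool) \<Rightarrow> nat set \<Rightarrow> nat set" where
  "U0 N M C X = {i. i < N \<and> i \<notin> X \<and> \<not> sure_zero N M C X i}"

definition U1 :: "nat \<Rightarrow> nat \<Rightarrow> (nat \<Rightarrow> nat \<Rightarrow> bool) \<Rightarrow> nat set \<Rightarrow> nat set" where
  "U1 N M C X = {i. i < N \<and> i \<in> X \<and> \<not> sure_one N M C X i}"

definition Tcost :: "nat \<Rightarrow> nat \<Rightarrow> (nat \<Rightarrow> nat \<Rightarrow> bool) \<Rightarrow> real \<Rightarrow> real" where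
  "Tcost N M C p = real M +
     (\<Sum>X\<in>configs N. mu N p X * real (card (U0 N M C X) + card (U1 N M C X)))"

definition P_RP :: "nat \<Rightarrow> nat \<Rightarrow> nat \<Rightarrow> (nat \<Rightarrow> nat \<Rightarrow> bool) \<Rightarrow> real" where
  "P_RP N M L C =
     (if C \<in> matrices N M \<and> (\<forall>i<N. card {a. a < M \<and> C i a} = L)
      then 1 / real (M choose L) ^ N else 0)"

definition Lbar :: "real \<Rightarrow> nat" where
  "Lbar p = nat \<lfloor>\<bar>ln p\<bar> / ln 2\<rfloor>"

definition Mbar :: "nat \<Rightarrow> real \<Rightarrow> nat" where
  "Mbar N p = nat \<lfloor>real N * p * \<bar>ln p\<bar> / (ln 2)\<^sup>2\<rfloor>"

definition avg_cost :: "nat \<Rightarrow> real \<Rightarrow> real" where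
  "avg_cost N p = (\<Sum>C\<in>matrices N (Mbar N p).
      P_RP N (Mbar N p) (Lbar p) C * (Tcost N (Mbar N p) C p / (real N * p * \<bar>ln p\<bar>)))"

text \<open>The limit lim_{N\<rightarrow>\<infinity>|\<beta>}: for \<beta> > 0 substitute p = N^(-\<beta>);
  for \<beta> = 0 take lim_{p\<rightarrow>0} lim_{N\<rightarrow>\<infinity>} (inner limit required to exist for all small p > 0).\<close>
definition lim_beta :: "real \<Rightarrow> (nat \<Rightarrow> real \<Rightarrow> real) \<Rightarrow> real \<Rightarrow> bool" where
  "lim_beta \<beta> f c =
     (if \<beta> > 0 then ((\<lambda>N. f N (real N powr (-\<beta>))) \<longlongrightarrow> c) sequentially
      else (\<exists>g. (\<forall>\<^sub>F p in at_right 0. ((\<lambda>N. f N p) \<longlongrightarrow> g p) sequentially)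
                \<and> (g \<longlongrightarrow> c) (at_right 0)))"

end

theory Submission
  imports Defs
begin

text \<open>
  By linearity the expected cost is \<open>M\<close> plus a sum over the items \<open>i\<close>, where \<open>S\<close> is the row of \<open>i\<close>, \<open>X\<close> the set
  of active items other than \<open>i\<close> and \<open>R\<close> the family of their rows. An inactive \<open>i\<close> is missed iff the
  rows of \<open>X\<close> cover \<open>S\<close>; an active \<open>i\<close> is missed with conditional probability at most \<open>1\<close>, which is
  negligible because its weight \<open>p\<close> is divided by \<open>p |ln p|\<close>.

  For the covering probability, the event that some active row meets \<open>S\<close> twice has
  probability \<open>O(L^3 / M)\<close>, and otherwise inclusion-exclusion over the tests in \<open>S\<close> gives
  \<open>(1 - exp (- n p L / M)) ^ L\<close>, which is of order \<open>2 ^ (- L)\<close>, hence of order \<open>p\<close>. All errors are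
  \<open>o(p |ln p|)\<close> as soon as \<open>N p^2 / |ln p|\<close> tends to infinity, which is where \<open>\<beta> < 1/2\<close> enters.

  For \<open>\<beta> = 0\<close> the inner limit has to exist for fixed \<open>p\<close>, so the probability of missing an active
  item must converge. Inclusion-exclusion reduces this to the event that every item whose row meets a
  given \<open>T \<subseteq> S\<close> is a sure zero. Given the active rows, the inactive rows are independent and each
  violates the event with a probability that depends only on the number of positive tests; that number
  concentrates by a second moment computation.
\<close>

section \<open>Averages over random rows and active sets\<close>

definition avg :: "'a set \<Rightarrow> ('a \<Rightarrow> real) \<Rightarrow> real" where
  "avg A f = (\<Sum>x\<in>A. f x) / real (card A)"

lemma avg_cong: "(\<And>x. x \<in> A \<Longrightarrow> f x = g x) \<Longrightarrow> avg A f = avg A g"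
  unfolding avg_def by (simp cong: sum.cong)

lemma avg_add: "avg A (\<lambda>x. f x + g x) = avg A f + avg A g"
  unfolding avg_def by (simp add: sum.distrib add_divide_distrib)

lemma avg_diff: "avg A (\<lambda>x. f x - g x) = avg A f - avg A g"
  unfolding avg_def by (simp add: sum_subtractf diff_divide_distrib)

lemma avg_cmult: "avg A (\<lambda>x. c * f x) = c * avg A f"
  unfolding avg_def by (simp add: sum_distrib_left)

lemma avg_multc: "avg A (\<lambda>x. f x * c) = avg A f * c"
  unfolding avg_def by (simp add: sum_distrib_right)

lemma avg_sum: "avg A (\<lambda>x. \<Sum>i\<in>I. f i x) = (\<Sum>i\<in>I. avg A (f i))"
  unfolding avg_def by (subst sum.swap) (simp add: sum_divide_distrib)

lemma avg_const: "finite A \<Longrightarrow> A \<noteq> {} \<Longrightarrow> avg A (\<lambda>x. c) = c"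
  unfolding avg_def by simp

lemma avg_mono: "(\<And>x. x \<in> A \<Longrightarrow> f x \<le> g x) \<Longrightarrow> avg A f \<le> avg A g"
  unfolding avg_def by (intro divide_right_mono sum_mono) auto

lemma avg_swap: "avg A (\<lambda>x. avg B (\<lambda>y. f x y)) = avg B (\<lambda>y. avg A (\<lambda>x. f x y))"
  unfolding avg_def
  by (simp add: sum_divide_distrib[symmetric]) (subst sum.swap, simp add: mult.commute)

lemma avg_of_bool: "finite A \<Longrightarrow> avg A (\<lambda>x. of_bool (P x)) = real (card {x \<in> A. P x}) / real (card A)"
  unfolding avg_def by (simp add: Int_def)

lemma avg_PiE_insert:
  assumes "finite J" "i \<notin> J"
  shows "avg (insert i J \<rightarrow>\<^sub>E A) h = avg A (\<lambda>S. avg (J \<rightarrow>\<^sub>E A) (\<lambda>R. h (R(i := S))))"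
proof -
  have "(\<Sum>R\<in>insert i J \<rightarrow>\<^sub>E A. h R) = (\<Sum>(S, R)\<in>A \<times> (J \<rightarrow>\<^sub>E A). h (R(i := S)))"
    unfolding PiE_insert_eq
    by (subst sum.reindex) (use inj_combinator[OF assms(2), of "\<lambda>_. A"] in \<open>auto simp: case_prod_unfold\<close>)
  also have "\<dots> = (\<Sum>S\<in>A. \<Sum>R\<in>J \<rightarrow>\<^sub>E A. h (R(i := S)))"
    by (simp add: sum.cartesian_product)
  finally show ?thesis
    using assms unfolding avg_def
    by (simp add: card_PiE sum_divide_distrib[symmetric] field_simps)
qed

lemma avg_PiE_prod:
  assumes "finite A" "finite J"
  shows "avg (J \<rightarrow>\<^sub>E A) (\<lambda>R. \<Prod>j\<in>J. f j (R j)) = (\<Prod>j\<in>J. avg A (f j))"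
  using assms unfolding avg_def
  by (simp add: prod_sum_PiE card_PiE prod_dividef)

text \<open>Once the rows indexed by \<open>X\<close> are fixed, those indexed by \<open>Y\<close>
  are independent and enter through separate factors, so each integrates out to
  \<open>avg A (g R)\<close>. The induction keeps \<open>f\<close> arbitrary because every step
  absorbs one such factor into it; \<open>restrict R X\<close> records that \<open>f\<close> and
  \<open>g\<close> see only the rows of \<open>X\<close>.\<close>

lemma avg_PiE_split:
  fixes X Y :: "'a set" and A :: "'b set"
  assumes "finite A" "A \<noteq> {}" "finite X" "finite Y" "X \<inter> Y = {}"
  shows "avg (X \<union> Y \<rightarrow>\<^sub>E A) (\<lambda>R. f (restrict R X) * (\<Prod>j\<in>Y. g (restrict R X) (R j)))
    = avg (X \<rightarrow>\<^sub>E A) (\<lambda>R. f R * avg A (g R) ^ card Y)"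
  using assms(4,5)
proof (induction Y arbitrary: f)
  case empty
  show ?case by (auto intro!: avg_cong arg_cong[where f = f] simp: PiE_restrict simp del: restrict_apply)
next
  case (insert y Y)
  have y: "y \<notin> X \<union> Y" using insert by auto
  have r: "restrict (R(y := S)) X = restrict R X" for R :: "'a \<Rightarrow> 'b" and S
    using y by (auto simp: restrict_def fun_eq_iff)
  have pr: "(\<Prod>j\<in>insert y Y. h ((R(y := S)) j)) = h S * (\<Prod>j\<in>Y. h (R j))"
    for h :: "'b \<Rightarrow> real" and R :: "'a \<Rightarrow> 'b" and S
  proof -
    have "(\<Prod>j\<in>Y. h ((R(y := S)) j)) = (\<Prod>j\<in>Y. h (R j))"
      using insert by (intro prod.cong) auto
    then show ?thesis using insert by simp
  qed
  have "avg (X \<union> insert y Y \<rightarrow>\<^sub>E A) (\<lambda>R. f (restrict R X) * (\<Prod>j\<in>insert y Y. g (restrict R X) (R j)))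
     = avg A (\<lambda>S. avg (X \<union> Y \<rightarrow>\<^sub>E A) (\<lambda>R. f (restrict R X) * (g (restrict R X) S * (\<Prod>j\<in>Y. g (restrict R X) (R j)))))"
    using assms(3) insert(1) y unfolding Un_insert_right
    by (subst avg_PiE_insert) (simp_all only: r pr finite_Un simp_thms)
  also have "\<dots> = avg (X \<union> Y \<rightarrow>\<^sub>E A) (\<lambda>R. (f (restrict R X) * avg A (g (restrict R X))) * (\<Prod>j\<in>Y. g (restrict R X) (R j)))"
    by (subst avg_swap) (simp add: avg_cmult avg_multc mult.assoc)
  also have "\<dots> = avg (X \<rightarrow>\<^sub>E A) (\<lambda>R. (f R * avg A (g R)) * avg A (g R) ^ card Y)"
    using insert by (subst insert.IH[of "\<lambda>R. f R * avg A (g R)"]) auto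
  also have "\<dots> = avg (X \<rightarrow>\<^sub>E A) (\<lambda>R. f R * avg A (g R) ^ card (insert y Y))"
    using insert by (simp add: mult.assoc)
  finally show ?case .
qed

section \<open>Sums over subsets and inclusion-exclusion\<close>

lemma sum_Pow_insert:
  assumes "finite J" "i \<notin> J"
  shows "(\<Sum>X\<in>Pow (insert i J). f X) = (\<Sum>X\<in>Pow J. f (insert i X)) + (\<Sum>X\<in>Pow J. f X :: real)"
proof -
  have "inj_on (insert i) (Pow J)"
    using assms(2) by (auto simp: inj_on_def insert_ident)
  moreover have "Pow J \<inter> insert i ` Pow J = {}" using assms(2) by auto
  ultimately show ?thesis
    using assms(1) unfolding Pow_insert by (subst sum.union_disjoint) (auto simp: sum.reindex)
qed

lemma of_bool_ball: "finite J \<Longrightarrow> (of_bool (\<forall>j\<in>J. P j) :: real) = (\<Prod>j\<in>J. of_bool (P j))"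
  by (induction J rule: finite_induct) auto

text \<open>The right side is the product over \<open>S\<close> of the factors
  \<open>1 - of_bool (P a)\<close>; expanding it means choosing the set \<open>T\<close> of those
  \<open>a\<close> that contribute the negative term.\<close>

lemma inclusion_exclusion:
  assumes "finite S"
  shows "(\<Sum>T\<in>Pow S. (-1) ^ card T * of_bool (\<forall>a\<in>T. P a)) = (of_bool (\<forall>a\<in>S. \<not> P a) :: real)"
proof -
  have pr: "(\<Prod>a\<in>T. of_bool (P a)) = (of_bool (\<forall>a\<in>T. P a) :: real)" if "T \<subseteq> S" for T P
    using finite_subset[OF that assms] by (simp only: of_bool_ball)
  have "of_bool (\<forall>a\<in>S. \<not> P a) = (\<Prod>a\<in>S. of_bool (\<not> P a) :: real)"
    using pr[of S "\<lambda>a. \<not> P a"] by simp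
  also have "\<dots> = (\<Prod>a\<in>S. (- 1) * of_bool (P a) + (1::real))"
    by (intro prod.cong) auto
  also have "\<dots> = (\<Sum>T\<in>Pow S. (\<Prod>a\<in>T. (- 1) * of_bool (P a)) * (\<Prod>a\<in>S-T. 1))"
    using assms by (rule prod_add)
  also have "\<dots> = (\<Sum>T\<in>Pow S. (-1) ^ card T * of_bool (\<forall>a\<in>T. P a))"
    by (intro sum.cong) (simp_all only: prod.distrib pr prod_constant Pow_iff mult_1_right power_one)
  finally show ?thesis by simp
qed

lemma sum_Pow_card:
  assumes "finite S"
  shows "(\<Sum>T\<in>Pow S. f (card T)) = (\<Sum>t\<le>card S. real (card S choose t) * f t)"
proof -
  have "(\<Sum>T\<in>Pow S. f (card T)) = (\<Sum>t\<le>card S. \<Sum>T\<in>{T\<in>Pow S. card T = t}. f (card T))"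
    using assms by (subst sum.group) (auto intro: card_mono)
  also have "\<dots> = (\<Sum>t\<le>card S. real (card S choose t) * f t)"
    by (intro sum.cong) (auto simp: n_subsets[OF assms, symmetric])
  finally show ?thesis .
qed

section \<open>Independent uniform rows with a random active set\<close>

locale random_rows =
  fixes A :: "'r set" and p :: real
  assumes finite_A: "finite A" and A_nonempty: "A \<noteq> {}" and p_nonneg: "0 \<le> p" and p_le_1: "p \<le> 1"
begin

text \<open>The items in \<open>J\<close> are active independently with probability
  \<open>p\<close>, \<open>X\<close> being the active ones, and carry independent uniform rows.
  Inactive items receive rows too, since these help decide whether an active item is a sure
  one.\<close>

definition expct :: "nat set \<Rightarrow> (nat set \<Rightarrow> (nat \<Rightarrow> 'r) \<Rightarrow> real) \<Rightarrow> real" where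
  "expct J h = (\<Sum>X\<in>Pow J. p ^ card X * (1 - p) ^ card (J - X) * avg (J \<rightarrow>\<^sub>E A) (h X))"

lemma expct_cong:
  "(\<And>X R. X \<subseteq> J \<Longrightarrow> R \<in> J \<rightarrow>\<^sub>E A \<Longrightarrow> f X R = g X R) \<Longrightarrow> expct J f = expct J g"
  unfolding expct_def by (intro sum.cong arg_cong2[where f = "(*)"] avg_cong) auto

lemma expct_add: "expct J (\<lambda>X R. f X R + g X R) = expct J f + expct J g"
  unfolding expct_def by (simp add: avg_add sum.distrib algebra_simps)

lemma expct_diff: "expct J (\<lambda>X R. f X R - g X R) = expct J f - expct J g"
  unfolding expct_def by (simp add: avg_diff sum_subtractf algebra_simps)

lemma expct_cmult: "expct J (\<lambda>X R. c * f X R) = c * expct J f"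
  unfolding expct_def by (simp add: avg_cmult sum_distrib_left algebra_simps)

lemma expct_sum: "expct J (\<lambda>X R. \<Sum>i\<in>I. f i X R) = (\<Sum>i\<in>I. expct J (f i))"
  unfolding expct_def by (subst sum.swap) (simp add: avg_sum sum_distrib_left)

lemma expct_mono:
  "(\<And>X R. X \<subseteq> J \<Longrightarrow> R \<in> J \<rightarrow>\<^sub>E A \<Longrightarrow> f X R \<le> g X R) \<Longrightarrow> expct J f \<le> expct J g"
  unfolding expct_def using p_nonneg p_le_1
  by (intro sum_mono mult_left_mono avg_mono) auto

text \<open>The pairs of state and row are independent across items; \<open>prod_add\<close> turns
  the product of two-term factors into the sum over active sets.\<close>

lemma expct_prod:
  assumes "finite J"
  shows "expct J (\<lambda>X R. \<Prod>j\<in>J. f j (j \<in> X) (R j))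
    = (\<Prod>j\<in>J. p * avg A (f j True) + (1 - p) * avg A (f j False))"
proof -
  have "p ^ card X * (1 - p) ^ card (J - X) * avg (J \<rightarrow>\<^sub>E A) (\<lambda>R. \<Prod>j\<in>J. f j (j \<in> X) (R j))
    = (\<Prod>j\<in>X. p * avg A (f j True)) * (\<Prod>j\<in>J - X. (1 - p) * avg A (f j False))"
    if "X \<in> Pow J" for X
  proof -
    have fX: "finite X" using assms that by (auto intro: finite_subset)
    have "avg (J \<rightarrow>\<^sub>E A) (\<lambda>R. \<Prod>j\<in>J. f j (j \<in> X) (R j)) = (\<Prod>j\<in>J. avg A (f j (j \<in> X)))"
      by (rule avg_PiE_prod[OF finite_A assms])
    also have "\<dots> = (\<Prod>j\<in>J - X. avg A (f j (j \<in> X))) * (\<Prod>j\<in>X. avg A (f j (j \<in> X)))"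
      using that assms by (intro prod.subset_diff) auto
    finally show ?thesis by (simp only: prod.distrib prod_constant) (simp add: mult_ac)
  qed
  then show ?thesis
    unfolding expct_def by (simp add: prod_add[OF assms])
qed

lemma expct_const: "finite J \<Longrightarrow> expct J (\<lambda>X R. c) = c"
  using expct_prod[of J "\<lambda>_ _ _. 1"] expct_cmult[of J c "\<lambda>_ _. 1"]
  by (simp add: avg_const finite_A A_nonempty)

text \<open>Conditioning on the state and the row of a single item, which is how the cost is later
  split into contributions of the items.\<close>

lemma expct_insert:
  assumes "finite J" "i \<notin> J"
  shows "expct (insert i J) h = avg A (\<lambda>S. p * expct J (\<lambda>X R. h (insert i X) (R(i := S)))
     + (1 - p) * expct J (\<lambda>X R. h X (R(i := S))))"
proof -
  have a: "insert i J - insert i X = J - X" "insert i J - X = insert i (J - X)" "finite X"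
       "i \<notin> X" if "X \<in> Pow J" for X
    using assms that by (auto intro: finite_subset)
  show ?thesis
    unfolding expct_def using assms
    by (subst sum_Pow_insert)
       (auto simp: avg_add avg_cmult avg_sum avg_PiE_insert a sum_distrib_left mult.assoc
          intro!: arg_cong2[where f = "(+)"] sum.cong)
qed

text \<open>With \<open>X\<close> and the active rows fixed, the inactive rows are independent and
  identically distributed, so a condition imposed on each of them separately contributes a
  power.\<close>

lemma expct_integrate_inactive:
  assumes "finite J"
  shows "expct J (\<lambda>X R. f X (restrict R X) * (\<Prod>j\<in>J - X. g X (restrict R X) (R j)))
    = expct J (\<lambda>X R. f X (restrict R X) * avg A (g X (restrict R X)) ^ card (J - X))"
proof -
  have "avg (J \<rightarrow>\<^sub>E A) (\<lambda>R. f X (restrict R X) * (\<Prod>j\<in>J - X. g X (restrict R X) (R j)))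
    = avg (J \<rightarrow>\<^sub>E A) (\<lambda>R. f X (restrict R X) * avg A (g X (restrict R X)) ^ card (J - X))"
    if "X \<in> Pow J" for X
  proof -
    have J: "J = X \<union> (J - X)" and f: "finite X" "finite (J - X)" "X \<inter> (J - X) = {}"
      using that assms by (auto intro: finite_subset)
    have 1: "avg (J \<rightarrow>\<^sub>E A) (\<lambda>R. f X (restrict R X) * (\<Prod>j\<in>J - X. g X (restrict R X) (R j)))
      = avg (X \<rightarrow>\<^sub>E A) (\<lambda>R. f X R * avg A (g X R) ^ card (J - X))"
      using avg_PiE_split[OF finite_A A_nonempty f, of "f X" "g X"] J by simp
    \<comment> \<open>The right side still averages over all of \<open>J\<close>; taking the
      inactive factors to be 1 removes the rows on which it does not depend.\<close>
    have 2: "avg (J \<rightarrow>\<^sub>E A) (\<lambda>R. f X (restrict R X) * avg A (g X (restrict R X)) ^ card (J - X))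
      = avg (X \<rightarrow>\<^sub>E A) (\<lambda>R. f X R * avg A (g X R) ^ card (J - X))"
      using avg_PiE_split[OF finite_A A_nonempty f, of "\<lambda>R. f X R * avg A (g X R) ^ card (J - X)" "\<lambda>_ _. 1"] J
      by (simp add: avg_const finite_A A_nonempty)
    show ?thesis unfolding 1 2 ..
  qed
  then show ?thesis unfolding expct_def by simp
qed

text \<open>Jensen's inequality for the square root, derived from
  \<open>2 * s * |Y| <= Y^2 + s^2\<close>. The positive \<open>\<delta>\<close> permits division by
  \<open>s\<close> even when the second moment vanishes.\<close>

lemma expct_abs_le_sqrt:
  assumes "finite J" "\<delta> > 0"
  shows "expct J (\<lambda>X R. \<bar>Y X R\<bar>) \<le> sqrt (expct J (\<lambda>X R. (Y X R)\<^sup>2) + \<delta>)"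
proof -
  define v where "v = expct J (\<lambda>X R. (Y X R)\<^sup>2)"
  define s where "s = sqrt (v + \<delta>)"
  have "0 = expct J (\<lambda>X R. 0)" using expct_const[OF assms(1)] by simp
  also have "\<dots> \<le> v" unfolding v_def by (rule expct_mono) auto
  finally have s: "s > 0" "s\<^sup>2 = v + \<delta>" unfolding s_def using assms(2) by auto
  have "expct J (\<lambda>X R. \<bar>Y X R\<bar>) \<le> expct J (\<lambda>X R. (1 / (2 * s)) * (Y X R)\<^sup>2 + s / 2)"
  proof (rule expct_mono)
    fix X R
    have "2 * s * \<bar>Y X R\<bar> \<le> (Y X R)\<^sup>2 + s\<^sup>2"
      using zero_le_power2[of "\<bar>Y X R\<bar> - s"] by (simp add: power2_diff algebra_simps)
    then show "\<bar>Y X R\<bar> \<le> (1 / (2 * s)) * (Y X R)\<^sup>2 + s / 2"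
      using s(1) by (simp add: field_simps power2_eq_square)
  qed
  also have "\<dots> = (1 / (2 * s)) * v + s / 2"
    unfolding v_def by (simp only: expct_add expct_cmult expct_const[OF assms(1)])
  also have "\<dots> \<le> s"
    using s assms(2) by (simp add: field_simps power2_eq_square)
  finally show ?thesis unfolding s_def v_def .
qed

end

section \<open>Rows with a fixed number of ones\<close>

definition row_supports :: "nat \<Rightarrow> nat \<Rightarrow> nat set set" where
  "row_supports M L = {R. R \<subseteq> {..<M} \<and> card R = L}"

lemma finite_rows: "finite (row_supports M L)"
  unfolding row_supports_def by simp

lemma card_rows: "card (row_supports M L) = M choose L"
  unfolding row_supports_def using n_subsets[of "{..<M}" L] by simp

text \<open>The probability that a uniform row misses a prescribed set of \<open>t\<close>
  tests.\<close>

definition rho :: "nat \<Rightarrow> nat \<Rightarrow> nat \<Rightarrow> real" where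
  "rho M L t = real ((M - t) choose L) / real (M choose L)"

lemma rho_0: "L \<le> M \<Longrightarrow> rho M L 0 = 1"
  unfolding rho_def by (simp add: binomial_eq_0_iff)

text \<open>A row that misses \<open>t\<close> tests is uniform on the other \<open>M - t\<close>
  and contains the next one with probability \<open>L / (M - t)\<close>. If fewer than
  \<open>L\<close> tests remain, both sides are 0.\<close>

lemma rho_Suc:
  assumes "t < M" "L \<le> M"
  shows "rho M L (Suc t) = rho M L t * (1 - real L / (real M - real t))"
proof (cases "L \<le> M - t")
  case True
  have "(M - t) * ((M - t - 1) choose L) = (M - t - L) * ((M - t) choose L)"
    by (rule binomial_absorb_comp[symmetric])
  then have "real (M - t) * real ((M - t - 1) choose L) = real (M - t - L) * real ((M - t) choose L)"
    by (metis of_nat_mult)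
  moreover have "M - t - 1 = M - Suc t" by simp
  moreover have "real (M - t - L) = real (M - t) - real L" using True by simp
  ultimately have "real ((M - Suc t) choose L) = real ((M - t) choose L) * (1 - real L / real (M - t))"
    using assms(1) by (simp add: field_simps)
  then show ?thesis unfolding rho_def using assms(1) by (simp add: of_nat_diff)
next
  case False
  then show ?thesis unfolding rho_def by (simp add: binomial_eq_0)
qed

lemma avg_rows_disjoint:
  assumes "T \<subseteq> {..<M}"
  shows "avg (row_supports M L) (\<lambda>R. of_bool (R \<inter> T = {})) = rho M L (card T)"
proof -
  have "{R \<in> row_supports M L. R \<inter> T = {}} = {R. R \<subseteq> {..<M} - T \<and> card R = L}"
    unfolding row_supports_def by auto
  then have "card {R \<in> row_supports M L. R \<inter> T = {}} = (M - card T) choose L"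
    using n_subsets[of "{..<M} - T" L] assms by (simp add: card_Diff_subset finite_subset)
  then show ?thesis by (simp add: avg_of_bool finite_rows card_rows rho_def)
qed

text \<open>The probability that a uniform row lies inside a set of \<open>w\<close> tests and meets
  a prescribed subset of size \<open>t\<close>. With the positive tests as the larger set, this is
  the chance that an inactive item belongs to one of the \<open>t\<close> tests without being a sure
  zero.\<close>

definition hit_within :: "nat \<Rightarrow> nat \<Rightarrow> nat \<Rightarrow> nat \<Rightarrow> real" where
  "hit_within M L t w = (real (w choose L) - real ((w - t) choose L)) / real (M choose L)"

lemma avg_rows_hit_within:
  assumes "T \<subseteq> W" "W \<subseteq> {..<M}"
  shows "avg (row_supports M L) (\<lambda>R. of_bool (R \<inter> T \<noteq> {} \<and> R \<subseteq> W)) = hit_within M L (card T) (card W)"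
proof -
  have fW: "finite W" using assms(2) finite_subset by auto
  have s: "{R \<in> row_supports M L. R \<inter> T \<noteq> {} \<and> R \<subseteq> W}
      = {R. R \<subseteq> W \<and> card R = L} - {R. R \<subseteq> W - T \<and> card R = L}"
    using assms unfolding row_supports_def by auto
  have "real (card ({R. R \<subseteq> W \<and> card R = L} - {R. R \<subseteq> W - T \<and> card R = L}))
     = real (card {R. R \<subseteq> W \<and> card R = L}) - real (card {R. R \<subseteq> W - T \<and> card R = L})"
    using fW by (subst card_Diff_subset) (auto intro!: of_nat_diff card_mono)
  also have "\<dots> = real (card W choose L) - real ((card W - card T) choose L)"
    using n_subsets[of "W - T" L] n_subsets[of W L] fW assms
    by (simp add: card_Diff_subset finite_subset)
  finally show ?thesis
    unfolding avg_of_bool[OF finite_rows] s hit_within_def card_rows by simp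
qed

lemma avg_rows_mem:
  assumes "a < M" "L \<le> M"
  shows "avg (row_supports M L) (\<lambda>R. of_bool (a \<in> R)) = real L / real M"
proof -
  have ne: "row_supports M L \<noteq> {}"
    using assms card_rows[of M L] by (metis binomial_eq_0_iff card.empty not_le)
  have "avg (row_supports M L) (\<lambda>R. of_bool (a \<in> R)) = avg (row_supports M L) (\<lambda>R. 1 - of_bool (R \<inter> {a} = {}))"
    by (intro avg_cong) auto
  also have "\<dots> = 1 - rho M L (Suc 0)"
    unfolding avg_diff using assms avg_rows_disjoint[of "{a}" M L]
    by (simp add: avg_const finite_rows ne)
  also have "\<dots> = real L / real M" using assms by (simp add: rho_Suc rho_0)
  finally show ?thesis .
qed

text \<open>Two memberships are negatively correlated: the exact probability is
  \<open>L * (L - 1) / (M * (M - 1))\<close>, and \<open>(L - 1) / (M - 1) <= L / M\<close>.\<close>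

lemma avg_rows_mem2_le:
  assumes "a < M" "b < M" "a \<noteq> b" "L \<le> M"
  shows "avg (row_supports M L) (\<lambda>R. of_bool (a \<in> R \<and> b \<in> R)) \<le> (real L / real M)\<^sup>2"
proof -
  have ne: "row_supports M L \<noteq> {}"
    using assms card_rows[of M L] by (metis binomial_eq_0_iff card.empty not_le)
  have M: "M \<ge> 2" using assms by linarith
  have "avg (row_supports M L) (\<lambda>R. of_bool (a \<in> R \<and> b \<in> R))
     = avg (row_supports M L) (\<lambda>R. of_bool (a \<in> R) - of_bool (R \<inter> {b} = {}) + of_bool (R \<inter> {a,b} = {}))"
    by (intro avg_cong) auto
  also have "\<dots> = real L / real M - rho M L 1 + rho M L 2"
    unfolding avg_diff avg_add using assms avg_rows_disjoint[of "{b}" M L] avg_rows_disjoint[of "{a,b}" M L]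
    by (simp add: avg_rows_mem numeral_2_eq_2)
  also have "\<dots> = real L / real M - real L / (real M - 1) + (real L / real M) * (real L / (real M - 1))"
  proof -
    have "x - (1 - x) + (1 - x) * (1 - y) = x - y + x * y" for x y :: real by (simp add: algebra_simps)
    moreover have "rho M L 1 = 1 - real L / real M"
      "rho M L 2 = (1 - real L / real M) * (1 - real L / (real M - 1))"
      using assms M by (simp_all add: numeral_2_eq_2 rho_Suc rho_0)
    ultimately show ?thesis by (simp only:)
  qed
  also have "\<dots> = (real L / real M) * ((real L - 1) / (real M - 1))"
  proof -
    have "real M \<noteq> 0" "real M - 1 \<noteq> 0" using M by auto
    then show ?thesis by (simp add: divide_simps) (simp add: algebra_simps)
  qed
  also have "\<dots> \<le> (real L / real M) * (real L / real M)"
    using assms M by (intro mult_left_mono) (auto simp: field_simps)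
  finally show ?thesis by (simp add: power2_eq_square)
qed

text \<open>Both bases lie in the unit interval, so their \<open>n\<close>-th powers differ by at
  most \<open>n\<close> times the difference of the bases, and \<open>exp (- x)\<close> lies between
  \<open>1 - x\<close> and \<open>1 - x + x^2\<close>.\<close>

lemma one_minus_power_exp:
  fixes x :: real
  assumes "0 \<le> x" "x \<le> 1"
  shows "\<bar>(1 - x) ^ n - exp (- (real n * x))\<bar> \<le> real n * x\<^sup>2"
proof -
  have "exp (- (real n * x)) = exp (- x) ^ n" by (simp add: exp_of_nat_mult[symmetric])
  moreover have "norm ((1 - x) ^ n - exp (- x) ^ n) \<le> real n * norm ((1 - x) - exp (- x))"
    using assms by (intro norm_power_diff) auto
  moreover have "\<bar>(1 - x) - exp (- x)\<bar> \<le> x\<^sup>2"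
  proof -
    have "1 - x \<le> exp (- x)" using exp_ge_add_one_self[of "- x"] by simp
    moreover have "exp (- x) \<le> 1 - x + x\<^sup>2"
    proof -
      have "(1 + x) * exp (- x) \<le> 1"
        using exp_ge_add_one_self[of x] by (simp add: exp_minus field_simps)
      then have "exp (- x) \<le> 1 / (1 + x)" using assms by (simp add: field_simps)
      also have "\<dots> \<le> 1 - x + x\<^sup>2"
      proof -
        have "(1 - x + x\<^sup>2) * (1 + x) = 1 + x ^ 3" by (simp add: algebra_simps power2_eq_square power3_eq_cube)
        then show ?thesis using assms by (simp add: divide_le_eq)
      qed
      finally show ?thesis .
    qed
    ultimately show ?thesis by simp
  qed
  ultimately show ?thesis using mult_left_mono[of _ "x\<^sup>2" "real n"]
    by (smt (verit) of_nat_0_le_iff real_norm_def)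
qed

lemma binomial_sum_alternating_power:
  "(\<Sum>t\<le>L. real (L choose t) * ((-1) ^ t * x ^ t)) = (1 - x) ^ L"
  using binomial_ring[of "- x" 1 L] by (simp add: power_mult_distrib[symmetric] mult.assoc)

text \<open>The sum is the probability that \<open>n\<close> independent throws fill all of
  \<open>L\<close> bins, a throw landing in any given bin with probability \<open>x\<close>.
  Replacing each power by an exponential costs at most \<open>n * (L * x)^2\<close> per term, the
  binomial coefficients add up to \<open>2 ^ L\<close>, and the exponential sum factorises by the
  binomial theorem.\<close>

lemma alternating_balls_in_bins_le:
  fixes x :: real
  assumes "0 \<le> x" "real L * x \<le> 1"
  shows "(\<Sum>t\<le>L. real (L choose t) * ((-1) ^ t * (1 - real t * x) ^ n))
    \<le> (1 - exp (- (real n * x))) ^ L + 2 ^ L * (real n * (real L * x)\<^sup>2)"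
proof -
  have b: "\<bar>(1 - real t * x) ^ n - exp (- (real n * x)) ^ t\<bar> \<le> real n * (real L * x)\<^sup>2" if "t \<le> L" for t
  proof -
    have tL: "real t * x \<le> real L * x" using that assms(1) by (intro mult_right_mono) auto
    have "exp (- (real n * x)) ^ t = exp (- (real n * (real t * x)))"
      by (simp add: exp_of_nat_mult[symmetric] algebra_simps)
    then have "\<bar>(1 - real t * x) ^ n - exp (- (real n * x)) ^ t\<bar> \<le> real n * (real t * x)\<^sup>2"
      using one_minus_power_exp[of "real t * x" n] tL assms by simp
    also have "\<dots> \<le> real n * (real L * x)\<^sup>2"
      using tL assms by (intro mult_left_mono power_mono) auto
    finally show ?thesis .
  qed
  have "(\<Sum>t\<le>L. real (L choose t) * ((-1) ^ t * (1 - real t * x) ^ n))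
    - (\<Sum>t\<le>L. real (L choose t) * ((-1) ^ t * exp (- (real n * x)) ^ t))
    = (\<Sum>t\<le>L. real (L choose t) * ((-1) ^ t * ((1 - real t * x) ^ n - exp (- (real n * x)) ^ t)))"
    by (simp add: sum_subtractf[symmetric] algebra_simps)
  also have "\<dots> \<le> (\<Sum>t\<le>L. real (L choose t) * (real n * (real L * x)\<^sup>2))"
  proof (intro sum_mono mult_left_mono)
    fix t assume "t \<in> {..L}"
    then have "\<bar>(-1) ^ t * ((1 - real t * x) ^ n - exp (- (real n * x)) ^ t)\<bar> \<le> real n * (real L * x)\<^sup>2"
      using b[of t] by (simp add: abs_mult power_abs)
    then show "(-1) ^ t * ((1 - real t * x) ^ n - exp (- (real n * x)) ^ t) \<le> real n * (real L * x)\<^sup>2"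
      by linarith
  qed auto
  also have "\<dots> = 2 ^ L * (real n * (real L * x)\<^sup>2)"
    using choose_row_sum[of L] by (simp add: sum_distrib_right[symmetric] of_nat_sum[symmetric] del: of_nat_sum)
  finally show ?thesis unfolding binomial_sum_alternating_power by simp
qed

text \<open>The probability that \<open>n\<close> items leave \<open>t\<close> prescribed tests
  negative: each is inactive, or active with a row missing them.\<close>

definition avoid_prob :: "nat \<Rightarrow> nat \<Rightarrow> real \<Rightarrow> nat \<Rightarrow> nat \<Rightarrow> real" where
  "avoid_prob M L p n t = (p * rho M L t + (1 - p)) ^ n"

section \<open>Items with \<open>L\<close> tests each among \<open>M\<close> tests\<close>

locale pooling =
  fixes M L :: nat and p :: real
  assumes L_le_M: "L \<le> M" and p01: "0 \<le> p" "p \<le> 1"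
begin

lemma rows_nonempty: "row_supports M L \<noteq> {}"
  using L_le_M card_rows[of M L] by (metis binomial_eq_0_iff card.empty not_le)

sublocale random_rows "row_supports M L" p
  by unfold_locales (use finite_rows rows_nonempty p01 in auto)

lemma avg1: "avg (row_supports M L) (\<lambda>R. c) = c"
  by (simp add: avg_const finite_rows rows_nonempty)

abbreviation avoid :: "nat \<Rightarrow> nat \<Rightarrow> real" where
  "avoid \<equiv> avoid_prob M L p"

text \<open>The quantity factorises over items: an active one contributes the probability of missing
  \<open>T\<close>, an inactive one the weight \<open>c\<close>. With \<open>c = 1\<close> this is
  the probability that \<open>T\<close> stays negative; other values of \<open>c\<close> account for
  inactive rows that have been integrated out.\<close>

lemma expct_avoid_weighted:
  assumes "finite J" "T \<subseteq> {..<M}"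
  shows "expct J (\<lambda>X R. of_bool (\<forall>j\<in>X. R j \<inter> T = {}) * c ^ card (J - X))
    = (p * rho M L (card T) + (1 - p) * c) ^ card J"
proof -
  have "expct J (\<lambda>X R. of_bool (\<forall>j\<in>X. R j \<inter> T = {}) * c ^ card (J - X))
    = expct J (\<lambda>X R. \<Prod>j\<in>J. if j \<in> X then of_bool (R j \<inter> T = {}) else c)"
  proof (rule expct_cong)
    fix X R assume "X \<subseteq> J"
    then have "(\<Prod>j\<in>J. if j \<in> X then of_bool (R j \<inter> T = {}) else c)
      = (\<Prod>j\<in>J - X. if j \<in> X then of_bool (R j \<inter> T = {}) else c) * (\<Prod>j\<in>X. if j \<in> X then of_bool (R j \<inter> T = {}) else c)"
      using assms by (intro prod.subset_diff)
    then show "of_bool (\<forall>j\<in>X. R j \<inter> T = {}) * c ^ card (J - X)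
      = (\<Prod>j\<in>J. if j \<in> X then of_bool (R j \<inter> T = {}) else c)"
      using \<open>X \<subseteq> J\<close> assms by (simp add: of_bool_ball finite_subset mult.commute)
  qed
  also have "\<dots> = (p * rho M L (card T) + (1 - p) * c) ^ card J"
    using expct_prod[OF assms(1), of "\<lambda>j b r. if b then of_bool (r \<inter> T = {}) else c"]
    by (simp add: avg_rows_disjoint[OF assms(2)] avg1)
  finally show ?thesis .
qed

lemma expct_avoid:
  assumes "finite J" "T \<subseteq> {..<M}"
  shows "expct J (\<lambda>X R. of_bool (\<forall>a\<in>T. a \<notin> (\<Union>j\<in>X. R j))) = avoid (card J) (card T)"
proof -
  have "expct J (\<lambda>X R. of_bool (\<forall>a\<in>T. a \<notin> (\<Union>j\<in>X. R j)))
     = expct J (\<lambda>X R. of_bool (\<forall>j\<in>X. R j \<inter> T = {}) * 1 ^ card (J - X))"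
    by (intro expct_cong) auto
  then show ?thesis unfolding avoid_prob_def using expct_avoid_weighted[OF assms, of 1] by simp
qed

lemma expct_inclusion_exclusion:
  assumes "finite S"
  shows "expct J (\<lambda>X R. of_bool (\<forall>a\<in>S. \<not> P X R a))
    = (\<Sum>T\<in>Pow S. (-1) ^ card T * expct J (\<lambda>X R. of_bool (\<forall>a\<in>T. P X R a)))"
  unfolding inclusion_exclusion[OF assms, symmetric] by (simp add: expct_sum expct_cmult)

text \<open>Inclusion-exclusion over the tests of \<open>S\<close> that no active row hits. The
  value is exact and depends on \<open>J\<close> only through its size, which suits a limit at fixed
  \<open>p\<close>.\<close>

lemma expct_covered:
  assumes "finite J" "S \<in> row_supports M L"
  shows "expct J (\<lambda>X R. of_bool (S \<subseteq> (\<Union>j\<in>X. R j)))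
     = (\<Sum>t\<le>L. real (L choose t) * ((-1) ^ t * avoid (card J) t))"
proof -
  have S: "S \<subseteq> {..<M}" "card S = L" "finite S"
    using assms(2) by (auto simp: row_supports_def finite_subset)
  have "expct J (\<lambda>X R. of_bool (S \<subseteq> (\<Union>j\<in>X. R j)))
    = expct J (\<lambda>X R. of_bool (\<forall>a\<in>S. \<not> (a \<notin> (\<Union>j\<in>X. R j))))"
    by (intro expct_cong) (auto simp: subset_iff)
  also have "\<dots> = (\<Sum>T\<in>Pow S. (-1) ^ card T * avoid (card J) (card T))"
    unfolding expct_inclusion_exclusion[OF S(3)]
    using S by (intro sum.cong refl arg_cong2[where f = "(*)"] expct_avoid assms) auto
  also have "\<dots> = (\<Sum>t\<le>L. real (L choose t) * ((-1) ^ t * avoid (card J) t))"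
    using sum_Pow_card[OF S(3), of "\<lambda>t. (-1) ^ t * avoid (card J) t"] S by simp
  finally show ?thesis .
qed

lemma expct_marginal:
  assumes "finite J" "j \<in> J"
  shows "expct J (\<lambda>X R. of_bool (j \<in> X \<and> P (R j))) = p * avg (row_supports M L) (\<lambda>r. of_bool (P r))"
proof -
  have "expct J (\<lambda>X R. of_bool (j \<in> X \<and> P (R j)))
    = expct J (\<lambda>X R. \<Prod>k\<in>J. if k = j then of_bool (k \<in> X \<and> P (R k)) else 1)"
    using assms by (intro expct_cong) simp
  also have "\<dots> = (\<Prod>k\<in>J. p * avg (row_supports M L) (\<lambda>r. if k = j then of_bool (P r) else 1)
      + (1 - p) * avg (row_supports M L) (\<lambda>r. if k = j then 0 else 1))"
    using expct_prod[OF assms(1), of "\<lambda>k b r. if k = j then of_bool (b \<and> P r) else 1"]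
    by (simp cong: if_cong)
  also have "\<dots> = (\<Prod>k\<in>J. if k = j then p * avg (row_supports M L) (\<lambda>r. of_bool (P r)) else 1)"
    by (intro prod.cong) (auto simp: avg1)
  finally show ?thesis using assms by simp
qed

end

section \<open>Estimates for the covering probability\<close>

lemma norm_prod_power_diff:
  fixes f :: "nat \<Rightarrow> real"
  assumes "\<And>i. i < k \<Longrightarrow> \<bar>f i\<bar> \<le> 1" "\<And>i. i < k \<Longrightarrow> \<bar>f i - x\<bar> \<le> d" "\<bar>x\<bar> \<le> 1"
  shows "\<bar>(\<Prod>i<k. f i) - x ^ k\<bar> \<le> real k * d"
proof -
  have "norm ((\<Prod>i<k. f i) - (\<Prod>i<k. x)) \<le> (\<Sum>i<k. norm (f i - x))"
    using assms by (intro norm_prod_diff) auto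
  also have "\<dots> \<le> (\<Sum>i<k. d)" using assms by (intro sum_mono) auto
  finally show ?thesis by simp
qed

lemma binomial_ratio_eq_prod:
  "real (m choose k) / real (n choose k) = (\<Prod>v<k. (real m - real v) / (real n - real v))"
proof -
  have *: "real (i choose k) = (\<Prod>v<k. (real i - real v)) / fact k" for i
    by (simp add: binomial_gbinomial gbinomial_prod_rev atLeast0LessThan)
  show ?thesis unfolding * by (simp add: prod_dividef)
qed

text \<open>The ratio is a product of \<open>k\<close> factors
  \<open>(w - u - v) / (M - 1 - v)\<close>, each close to \<open>w / M\<close> and hence to
  \<open>\<omega>\<close>; replacing the factors one at a time adds up the errors.\<close>

lemma binomial_ratio_approx:
  assumes "u \<le> w" "w \<le> M" "u \<le> L" "1 \<le> u" "k < L" "2 * L < M" "0 \<le> \<omega>" "\<omega> \<le> 1"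
  shows "\<bar>real ((w - u) choose k) / real ((M - 1) choose k) - \<omega> ^ k\<bar>
     \<le> real k * (3 * real L / (real M - real L) + \<bar>real w / real M - \<omega>\<bar>)"
proof -
  have M: "real M > 0" "real M - real L > 0" using assms by auto
  have e: "real (w - u) = real w - real u" "real (M - 1) = real M - 1" using assms by auto
  show ?thesis
    unfolding binomial_ratio_eq_prod
  proof (rule norm_prod_power_diff)
    fix v assume v: "v < k"
    have d: "real M - 1 - real v > 0" "real M - real L \<le> real M - 1 - real v" using v assms by auto
    \<comment> \<open>The numerator is negative when \<open>w - u < v\<close>; its modulus is then
      at most \<open>v\<close>, and \<open>2 * L < M\<close> gives the bound.\<close>
    have "\<bar>real w - real u - real v\<bar> \<le> real M - 1 - real v" using v assms by linarith
    then show "\<bar>(real (w - u) - real v) / (real (M - 1) - real v)\<bar> \<le> 1"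
      unfolding e using d by simp
    have "(real w - real u - real v) / (real M - 1 - real v) - real w / real M
       = (real w * (1 + real v) - (real u + real v) * real M) / (real M * (real M - 1 - real v))"
      using d M by (simp add: field_simps)
    \<comment> \<open>Here \<open>1 + v <= L\<close> and \<open>w <= M\<close> bound the first
      product by \<open>L * M\<close>, and \<open>u + v <= 2 * L\<close> bounds the second by twice
      that, whence the constant 3.\<close>
    also have "\<bar>\<dots>\<bar> \<le> (3 * real L * real M) / (real M * (real M - 1 - real v))"
    proof -
      have "real w * (1 + real v) \<le> real M * real L"
        using assms v by (intro mult_mono) auto
      moreover have "(real u + real v) * real M \<le> (2 * real L) * real M"
        using assms v by (intro mult_right_mono) auto
      moreover have "0 \<le> real w * (1 + real v)" "0 \<le> (real u + real v) * real M" by auto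
      ultimately have "\<bar>real w * (1 + real v) - (real u + real v) * real M\<bar> \<le> 3 * real L * real M"
        using mult.commute[of "real L" "real M"] by linarith
      moreover have "\<bar>real M * (real M - 1 - real v)\<bar> = real M * (real M - 1 - real v)"
        using d M by (intro abs_of_nonneg mult_nonneg_nonneg) auto
      ultimately show ?thesis unfolding abs_divide
        using d M by (simp only:) (intro divide_right_mono mult_nonneg_nonneg, auto)
    qed
    also have "\<dots> = 3 * real L / (real M - 1 - real v)" using M by simp
    also have "\<dots> \<le> 3 * real L / (real M - real L)"
      using d M by (intro divide_left_mono) auto
    finally show "\<bar>(real (w - u) - real v) / (real (M - 1) - real v) - \<omega>\<bar>
       \<le> 3 * real L / (real M - real L) + \<bar>real w / real M - \<omega>\<bar>"
      unfolding e by linarith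
  qed (use assms in auto)
qed

text \<open>Pascal's rule iterated \<open>t\<close> times. Combinatorially, the \<open>u\<close>-th
  term counts the sets whose first element from an ordered \<open>t\<close>-set is the
  \<open>u\<close>-th.\<close>

lemma binomial_diff_eq_sum:
  assumes "t \<le> w"
  shows "real (w choose Suc k) - real ((w - t) choose Suc k) = (\<Sum>u=1..t. real ((w - u) choose k))"
  using assms
proof (induction t)
  case (Suc t)
  have "w - t = Suc (w - Suc t)" using Suc.prems by simp
  then have "real ((w - t) choose Suc k) = real ((w - Suc t) choose k) + real ((w - Suc t) choose Suc k)"
    by (metis binomial_Suc_Suc of_nat_add)
  then show ?case using Suc by simp
qed simp

text \<open>A row contains a given test with probability \<open>L / M\<close>, and its other
  \<open>L - 1\<close> tests then fall among the \<open>w\<close> ones with probability about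
  \<open>\<omega> ^ (L - 1)\<close>. Formally, \<open>hit_within\<close> is \<open>L / M\<close>
  times a sum of \<open>t\<close> binomial ratios, each handled by
  \<open>binomial_ratio_approx\<close>.\<close>

lemma hit_within_approx:
  assumes "t \<le> L" "t \<le> w" "w \<le> M" "2 * L < M" "0 < L" "0 \<le> \<omega>" "\<omega> \<le> 1"
  shows "\<bar>hit_within M L t w - real t * real L * \<omega> ^ (L - 1) / real M\<bar>
    \<le> (real L)^3 / real M * (3 * real L / (real M - real L) + \<bar>real w / real M - \<omega>\<bar>)"
proof -
  obtain k where L: "L = Suc k" using assms by (cases L) auto
  obtain m where M: "M = Suc m" using assms by (cases M) auto
  define d where "d = 3 * real L / (real M - real L) + \<bar>real w / real M - \<omega>\<bar>"
  have d: "d \<ge> 0" unfolding d_def using assms by auto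
  have "real L * real (M choose L) = real M * real (m choose k)"
    unfolding L M using Suc_times_binomial_eq[of m k] by (metis mult.commute of_nat_mult)
  moreover have "real (M choose L) > 0" "real (m choose k) > 0"
    using assms L M by (auto simp: zero_less_binomial_iff simp del: binomial_Suc_Suc)
  ultimately have r: "1 / real (M choose L) = real L / real M / real (m choose k)"
    using M by (simp only: divide_divide_eq_left) (simp add: frac_eq_eq)
  have "hit_within M L t w = (\<Sum>u=1..t. real ((w - u) choose k)) * (1 / real (M choose L))"
    unfolding hit_within_def L binomial_diff_eq_sum[OF assms(2)] by simp
  also have "\<dots> = real L / real M * (\<Sum>u=1..t. real ((w - u) choose k) / real (m choose k))"
    unfolding r by (simp add: sum_divide_distrib[symmetric])
  finally have "hit_within M L t w - real t * real L * \<omega> ^ (L - 1) / real M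
     = real L / real M * (\<Sum>u=1..t. real ((w - u) choose k) / real (m choose k) - \<omega> ^ k)"
    using L by (simp add: sum_subtractf algebra_simps)
  also have "\<bar>\<dots>\<bar> \<le> real L / real M * (\<Sum>u=1..t. real k * d)"
    unfolding abs_mult
  proof (intro mult_mono order.trans[OF sum_abs] sum_mono)
    fix u assume "u \<in> {1..t}"
    then show "\<bar>real ((w - u) choose k) / real (m choose k) - \<omega> ^ k\<bar> \<le> real k * d"
      unfolding d_def using binomial_ratio_approx[of u w M L k \<omega>] assms L M by auto
  qed auto
  also have "\<dots> = (real L * real t * real k) / real M * d" by simp
  also have "\<dots> \<le> (real L * real L * real L) / real M * d"
    using assms L d by (intro mult_right_mono divide_right_mono mult_mono) auto
  finally show ?thesis unfolding d_def by (simp add: power3_eq_cube)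
qed

section \<open>Probability that the active rows cover a given row\<close>

context pooling
begin

text \<open>Union bound over ordered pairs of distinct tests of \<open>S\<close>: at most
  \<open>L * L\<close> pairs, each contained in the row with probability at most
  \<open>(L / M)^2\<close>.\<close>

lemma avg_rows_double_hit_le:
  assumes "S \<in> row_supports M L"
  shows "avg (row_supports M L) (\<lambda>R. of_bool (card (R \<inter> S) \<ge> 2)) \<le> real L ^ 4 / real M ^ 2"
proof -
  have S: "S \<subseteq> {..<M}" "card S = L" "finite S"
    using assms by (auto simp: row_supports_def finite_subset)
  define D where "D = {x \<in> S \<times> S. fst x \<noteq> snd x}"
  have D: "finite D" "card D \<le> L * L"
    unfolding D_def using S card_mono[of "S \<times> S" "{x \<in> S \<times> S. fst x \<noteq> snd x}"]
    by (auto simp: card_cartesian_product)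
  have "avg (row_supports M L) (\<lambda>R. of_bool (card (R \<inter> S) \<ge> 2))
     \<le> avg (row_supports M L) (\<lambda>R. \<Sum>x\<in>D. of_bool (fst x \<in> R \<and> snd x \<in> R))"
  proof (rule avg_mono)
    fix R
    show "of_bool (card (R \<inter> S) \<ge> 2) \<le> (\<Sum>x\<in>D. of_bool (fst x \<in> R \<and> snd x \<in> R) :: real)"
    proof (cases "card (R \<inter> S) \<ge> 2")
      case True
      then obtain a b where ab: "a \<in> R \<inter> S" "b \<in> R \<inter> S" "a \<noteq> b"
        using card_le_Suc0_iff_eq[of "R \<inter> S"] S(3) by (auto simp: not_le[symmetric])
      then have "(a, b) \<in> D" by (simp add: D_def)
      then have "(\<Sum>x\<in>{(a,b)}. of_bool (fst x \<in> R \<and> snd x \<in> R) :: real)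
         \<le> (\<Sum>x\<in>D. of_bool (fst x \<in> R \<and> snd x \<in> R))"
        using D by (intro sum_mono2) auto
      then show ?thesis using True ab by simp
    qed (auto intro!: sum_nonneg)
  qed
  also have "\<dots> = (\<Sum>x\<in>D. avg (row_supports M L) (\<lambda>R. of_bool (fst x \<in> R \<and> snd x \<in> R)))"
    by (rule avg_sum)
  also have "\<dots> \<le> (\<Sum>x\<in>D. (real L / real M)\<^sup>2)"
    using S L_le_M by (intro sum_mono avg_rows_mem2_le) (auto simp: D_def)
  also have "\<dots> \<le> real (L * L) * (real L / real M)\<^sup>2"
    using of_nat_mono[OF D(2), where 'a = real] by (simp add: mult_right_mono)
  also have "\<dots> = real L ^ 4 / real M ^ 2"
    by (simp add: power_divide power2_eq_square power4_eq_xxxx)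
  finally show ?thesis .
qed

lemma avg_rows_single_hit:
  assumes "S \<in> row_supports M L" "a \<in> S"
  shows "avg (row_supports M L) (\<lambda>R. of_bool (R \<inter> S = {a})) = rho M L (L - 1) - rho M L L"
proof -
  have S: "S \<subseteq> {..<M}" "card S = L" "finite S"
    using assms by (auto simp: row_supports_def finite_subset)
  have "avg (row_supports M L) (\<lambda>R. of_bool (R \<inter> S = {a}))
    = avg (row_supports M L) (\<lambda>R. of_bool (R \<inter> (S - {a}) = {}) - of_bool (R \<inter> S = {}))"
    using assms(2) by (intro avg_cong) (auto simp: set_eq_iff)
  then show ?thesis
    unfolding avg_diff using avg_rows_disjoint[of "S - {a}" M L] avg_rows_disjoint[of S M L] S assms(2)
    by (simp add: subset_iff)
qed

text \<open>The event \<open>R \<inter> S = {a}\<close> implies \<open>a \<in> R\<close>, which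
  gives the second bound. For different \<open>a\<close> these events exclude each other, so their
  \<open>L\<close> equal probabilities add up to at most 1.\<close>

lemma single_hit_bounds:
  assumes "0 < L"
  shows "0 \<le> rho M L (L - 1) - rho M L L" "rho M L (L - 1) - rho M L L \<le> real L / real M"
    "real L * (rho M L (L - 1) - rho M L L) \<le> 1"
proof -
  obtain S where S: "S \<in> row_supports M L" using rows_nonempty by auto
  have S': "S \<subseteq> {..<M}" "card S = L" "finite S"
    using S by (auto simp: row_supports_def finite_subset)
  then obtain a where a: "a \<in> S" using assms by fastforce
  note e = avg_rows_single_hit[OF S a]
  have "avg (row_supports M L) (\<lambda>R. 0) \<le> avg (row_supports M L) (\<lambda>R. of_bool (R \<inter> S = {a}))"
    by (intro avg_mono) auto
  then show "0 \<le> rho M L (L - 1) - rho M L L" unfolding e avg1 .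
  have "avg (row_supports M L) (\<lambda>R. of_bool (R \<inter> S = {a})) \<le> avg (row_supports M L) (\<lambda>R. of_bool (a \<in> R))"
    by (intro avg_mono) auto
  then show "rho M L (L - 1) - rho M L L \<le> real L / real M"
    unfolding e using avg_rows_mem[of a M L] L_le_M a S' by auto
  have "(\<Sum>b\<in>S. avg (row_supports M L) (\<lambda>R. of_bool (R \<inter> S = {b}))) \<le> avg (row_supports M L) (\<lambda>R. 1)"
    unfolding avg_sum[symmetric]
  proof (rule avg_mono)
    fix R
    \<comment> \<open>If the intersection is a singleton, its element is the only \<open>b\<close>
      that can contribute.\<close>
    have "(\<Sum>b\<in>S. of_bool (R \<inter> S = {b}) :: real) \<le> (\<Sum>b\<in>S. if b = the_elem (R \<inter> S) then 1 else 0)"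
      by (intro sum_mono) auto
    also have "\<dots> \<le> 1" using S' by (simp add: sum.delta)
    finally show "(\<Sum>b\<in>S. of_bool (R \<inter> S = {b}) :: real) \<le> 1" .
  qed
  then show "real L * (rho M L (L - 1) - rho M L L) \<le> 1"
    using S' by (simp add: avg_rows_single_hit[OF S] avg1)
qed

text \<open>Either some active row meets \<open>S\<close> twice, which the first term covers by a
  union bound, or every test of \<open>S\<close> is hit by an active row meeting \<open>S\<close> in
  that test alone. The latter is a balls-in-bins event with probability \<open>x\<close> per bin, so
  \<open>alternating_balls_in_bins_le\<close> applies. Allowing any \<open>n\<close> above
  \<open>card J\<close> lets the bound be stated with \<open>N\<close> although there are only
  \<open>N - 1\<close> other items.\<close>

lemma expct_covered_le:
  assumes J: "finite J" and Srow: "S \<in> row_supports M L" and L: "0 < L" and n: "card J \<le> n"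
  shows "expct J (\<lambda>X R. of_bool (S \<subseteq> (\<Union>j\<in>X. R j)))
    \<le> real n * p * (real L ^ 4 / real M ^ 2) + (1 - exp (- (real n * (p * real L / real M)))) ^ L
       + 2 ^ L * (real n * (real L * (p * real L / real M))\<^sup>2)"
proof -
  have S: "S \<subseteq> {..<M}" "card S = L" "finite S"
    using Srow by (auto simp: row_supports_def finite_subset)
  define e where "e = rho M L (L - 1) - rho M L L"
  define x where "x = p * e"
  have e: "0 \<le> e" "e \<le> real L / real M" "real L * e \<le> 1"
    unfolding e_def using single_hit_bounds[OF L] by auto
  have x: "0 \<le> x" "x \<le> p * real L / real M" "real L * x \<le> 1"
  proof -
    show "0 \<le> x" "x \<le> p * real L / real M"
      unfolding x_def using e p01 mult_left_mono[OF e(2) p01(1)] by auto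
    have "p * (real L * e) \<le> 1 * 1" using e p01 by (intro mult_mono) auto
    then show "real L * x \<le> 1" unfolding x_def by (simp add: algebra_simps)
  qed
  have "expct J (\<lambda>X R. of_bool (S \<subseteq> (\<Union>j\<in>X. R j)))
    \<le> expct J (\<lambda>X R. (\<Sum>j\<in>J. of_bool (j \<in> X \<and> card (R j \<inter> S) \<ge> 2))
        + of_bool (\<forall>a\<in>S. \<not> (\<forall>j\<in>X. R j \<inter> S \<noteq> {a})))"
  proof (rule expct_mono)
    fix X R assume X: "X \<subseteq> J"
    show "of_bool (S \<subseteq> (\<Union>j\<in>X. R j)) \<le> (\<Sum>j\<in>J. of_bool (j \<in> X \<and> card (R j \<inter> S) \<ge> 2))
        + (of_bool (\<forall>a\<in>S. \<not> (\<forall>j\<in>X. R j \<inter> S \<noteq> {a})) :: real)"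
    proof (cases "\<exists>j\<in>X. card (R j \<inter> S) \<ge> 2")
      case True
      then obtain j where j: "j \<in> X" "card (R j \<inter> S) \<ge> 2" by auto
      have "(\<Sum>j\<in>{j}. of_bool (j \<in> X \<and> card (R j \<inter> S) \<ge> 2) :: real)
         \<le> (\<Sum>j\<in>J. of_bool (j \<in> X \<and> card (R j \<inter> S) \<ge> 2))"
        using J X j by (intro sum_mono2) auto
      then show ?thesis using j by simp
    next
      case False
      have "\<exists>j\<in>X. R j \<inter> S = {a}" if a: "a \<in> S" and cov: "S \<subseteq> (\<Union>j\<in>X. R j)" for a
      proof -
        obtain j where j: "j \<in> X" "a \<in> R j" using a cov by auto
        have "card (R j \<inter> S) \<le> 1" using False j by (auto simp: not_le)
        then have "R j \<inter> S = {a}"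
          using S(3) a j card_le_Suc0_iff_eq[of "R j \<inter> S"] by auto
        then show ?thesis using j by auto
      qed
      moreover have "0 \<le> (\<Sum>j\<in>J. of_bool (j \<in> X \<and> card (R j \<inter> S) \<ge> 2) :: real)"
        by (intro sum_nonneg) auto
      ultimately show ?thesis by (cases "S \<subseteq> (\<Union>j\<in>X. R j)") auto
    qed
  qed
  also have "\<dots> = (\<Sum>j\<in>J. p * avg (row_supports M L) (\<lambda>r. of_bool (card (r \<inter> S) \<ge> 2)))
      + expct J (\<lambda>X R. of_bool (\<forall>a\<in>S. \<not> (\<forall>j\<in>X. R j \<inter> S \<noteq> {a})))"
    unfolding expct_add expct_sum
    using expct_marginal[OF J, of _ "\<lambda>r. card (r \<inter> S) \<ge> 2"] by simp
  also have "expct J (\<lambda>X R. of_bool (\<forall>a\<in>S. \<not> (\<forall>j\<in>X. R j \<inter> S \<noteq> {a})))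
     = (\<Sum>T\<in>Pow S. (-1) ^ card T * (1 - real (card T) * x) ^ card J)"
    unfolding expct_inclusion_exclusion[OF S(3)]
  proof (intro sum.cong refl arg_cong2[where f = "(*)"])
    fix T assume T: "T \<in> Pow S"
    have fT: "finite T" using T S(3) finite_subset by auto
    have "expct J (\<lambda>X R. of_bool (\<forall>a\<in>T. \<forall>j\<in>X. R j \<inter> S \<noteq> {a}))
      = expct J (\<lambda>X R. \<Prod>j\<in>J. of_bool (j \<in> X \<longrightarrow> (\<forall>a\<in>T. R j \<inter> S \<noteq> {a})))"
      by (intro expct_cong) (auto simp: of_bool_ball[OF J, symmetric])
    also have "\<dots> = (p * avg (row_supports M L) (\<lambda>r. of_bool (\<forall>a\<in>T. r \<inter> S \<noteq> {a})) + (1 - p)) ^ card J"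
      using expct_prod[OF J, of "\<lambda>j b r. of_bool (b \<longrightarrow> (\<forall>a\<in>T. r \<inter> S \<noteq> {a}))"]
      by (simp add: avg1)
    \<comment> \<open>The events \<open>r \<inter> S = {a}\<close> for distinct \<open>a\<close> are
      mutually exclusive, so their indicators add and the probability is exactly linear in
      \<open>card T\<close>.\<close>
    also have "avg (row_supports M L) (\<lambda>r. of_bool (\<forall>a\<in>T. r \<inter> S \<noteq> {a}))
       = avg (row_supports M L) (\<lambda>r. 1 - (\<Sum>a\<in>T. of_bool (r \<inter> S = {a})))"
    proof (rule avg_cong)
      fix r
      show "of_bool (\<forall>a\<in>T. r \<inter> S \<noteq> {a}) = 1 - (\<Sum>a\<in>T. of_bool (r \<inter> S = {a}) :: real)"
      proof (cases "\<exists>b\<in>T. r \<inter> S = {b}")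
        case True
        then obtain b where b: "b \<in> T" "r \<inter> S = {b}" by auto
        then have "(\<Sum>a\<in>T. of_bool (r \<inter> S = {a}) :: real) = (\<Sum>a\<in>T. if a = b then 1 else 0)"
          by (intro sum.cong) auto
        then show ?thesis using b fT by auto
      qed auto
    qed
    also have "\<dots> = 1 - real (card T) * e"
      unfolding avg_diff avg1 avg_sum e_def
      using T avg_rows_single_hit[OF Srow] by (simp add: subset_iff)
    also have "p * (1 - real (card T) * e) + (1 - p) = 1 - real (card T) * x"
      by (simp add: x_def algebra_simps)
    finally show "expct J (\<lambda>X R. of_bool (\<forall>a\<in>T. \<forall>j\<in>X. R j \<inter> S \<noteq> {a}))
      = (1 - real (card T) * x) ^ card J" .
  qed
  also have "\<dots> = (\<Sum>t\<le>L. real (L choose t) * ((-1) ^ t * (1 - real t * x) ^ card J))"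
    using sum_Pow_card[OF S(3), of "\<lambda>t. (-1) ^ t * (1 - real t * x) ^ card J"] S by simp
  also have "(\<Sum>j\<in>J. p * avg (row_supports M L) (\<lambda>r. of_bool (card (r \<inter> S) \<ge> 2)))
     \<le> real n * p * (real L ^ 4 / real M ^ 2)"
  proof -
    have "(\<Sum>j\<in>J. p * avg (row_supports M L) (\<lambda>r. of_bool (card (r \<inter> S) \<ge> 2)))
       \<le> (\<Sum>j\<in>J. p * (real L ^ 4 / real M ^ 2))"
      using avg_rows_double_hit_le[OF Srow] p01 by (intro sum_mono mult_left_mono) auto
    also have "\<dots> = real (card J) * (p * (real L ^ 4 / real M ^ 2))" by simp
    also have "\<dots> \<le> real n * (p * (real L ^ 4 / real M ^ 2))"
      using n p01 by (intro mult_right_mono) auto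
    finally show ?thesis by (simp add: mult.assoc)
  qed
  also have "(\<Sum>t\<le>L. real (L choose t) * ((-1) ^ t * (1 - real t * x) ^ card J))
     \<le> (1 - exp (- (real (card J) * x))) ^ L + 2 ^ L * (real (card J) * (real L * x)\<^sup>2)"
    by (rule alternating_balls_in_bins_le[OF x(1,3)])
  \<comment> \<open>Both remaining terms increase with the number of items and with
    \<open>x\<close>, so these may be replaced by \<open>n\<close> and
    \<open>p * L / M\<close>.\<close>
  also have "(1 - exp (- (real (card J) * x))) ^ L \<le> (1 - exp (- (real n * (p * real L / real M)))) ^ L"
  proof (rule power_mono)
    have "real (card J) * x \<le> real n * (p * real L / real M)"
      using n x by (intro mult_mono) auto
    then show "1 - exp (- (real (card J) * x)) \<le> 1 - exp (- (real n * (p * real L / real M)))" by simp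
    show "0 \<le> 1 - exp (- (real (card J) * x))" using x by simp
  qed
  also have "2 ^ L * (real (card J) * (real L * x)\<^sup>2) \<le> 2 ^ L * (real n * (real L * (p * real L / real M))\<^sup>2)"
    using n x by (intro mult_left_mono mult_mono power_mono) auto
  finally show ?thesis by simp
qed

end

section \<open>Unresolved active items\<close>

lemma sum_distinct_pairs:
  fixes x y :: real
  assumes "finite B"
  shows "(\<Sum>a\<in>B. \<Sum>b\<in>B. if a = b then x else y)
     = real (card B) * x + real (card B) * (real (card B) - 1) * y"
proof -
  have "(\<Sum>b\<in>B. if a = b then x else y) = x + (real (card B) - 1) * y" if "a \<in> B" for a
  proof -
    have "(\<Sum>b\<in>B. if a = b then x else y) = (\<Sum>b\<in>B. y + (if a = b then x - y else 0))"
      by (intro sum.cong) auto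
    also have "\<dots> = real (card B) * y + (x - y)"
      using assms that by (simp add: sum.distrib)
    finally show ?thesis by (simp add: algebra_simps)
  qed
  then have "(\<Sum>a\<in>B. \<Sum>b\<in>B. if a = b then x else y) = (\<Sum>a\<in>B. x + (real (card B) - 1) * y)"
    by (intro sum.cong) auto
  then show ?thesis by (simp add: algebra_simps)
qed

text \<open>Here \<open>v\<close> stands for the limiting fraction of negative tests.\<close>

definition unresolved_prob :: "nat \<Rightarrow> nat \<Rightarrow> real \<Rightarrow> real \<Rightarrow> nat \<Rightarrow> nat \<Rightarrow> real" where
  "unresolved_prob M L p v n t
    = (p * rho M L t + (1 - p) * (1 - real t * real L * (1 - v) ^ (L - 1) / real M)) ^ n"

text \<open>The square root bounds the mean deviation of the fraction of positive tests from
  \<open>1 - v\<close>: it contains the second moment and the slack \<open>1 / M\<close> used as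
  \<open>\<delta>\<close> in \<open>expct_abs_le_sqrt\<close>. The other factors turn this into an
  error for \<open>n\<close> items by way of \<open>hit_within_approx\<close>.\<close>

definition unresolved_err :: "nat \<Rightarrow> nat \<Rightarrow> real \<Rightarrow> real \<Rightarrow> nat \<Rightarrow> real" where
  "unresolved_err M L p v n = real n / real M * real L ^ 3 * (3 * real L / (real M - real L)
     + sqrt (v\<^sup>2 - 2 * v * ((real M - real L) / real M) * avoid_prob M L p n 1
      + (real M - real L) / real M * (avoid_prob M L p n 1 / real M)
      + (real M - real L) / real M * ((real M - real L - 1) / real M) * avoid_prob M L p n 2 + 1 / real M))"

section \<open>Items that are not sure zeros, given the active rows\<close>

context pooling
begin

text \<open>The tests with outcome 1 when an item with row \<open>S\<close> is active together with
  the items in \<open>X\<close>.\<close>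

definition positive :: "nat set \<Rightarrow> nat set \<Rightarrow> (nat \<Rightarrow> nat set) \<Rightarrow> nat set" where
  "positive S X R = S \<union> (\<Union>j\<in>X. R j)"

lemma positive_bounds:
  assumes "S \<in> row_supports M L" "X \<subseteq> J" "R \<in> J \<rightarrow>\<^sub>E row_supports M L"
  shows "positive S X R \<subseteq> {..<M}" "finite (positive S X R)"
    "card (positive S X R) \<le> M" "L \<le> card (positive S X R)"
proof -
  show *: "positive S X R \<subseteq> {..<M}"
    using assms unfolding positive_def row_supports_def by fastforce
  then show **: "finite (positive S X R)" using finite_subset by auto
  show "card (positive S X R) \<le> M" using card_mono[OF _ *] by simp
  have "S \<subseteq> positive S X R" "card S = L" using assms unfolding positive_def row_supports_def by auto
  then show "L \<le> card (positive S X R)" using card_mono[OF **] by auto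
qed

text \<open>An item whose row lies inside the positive tests is not a sure zero; the event says that
  no such item belongs to a test in \<open>T\<close>. Active items must therefore miss
  \<open>T\<close>, while each inactive one, given the active rows, violates the event with
  probability \<open>hit_within\<close>. Were that probability the constant \<open>c\<close>,
  \<open>expct_avoid_weighted\<close> would give the power exactly; the replacement costs at most
  the deviation once per item.\<close>

lemma expct_unresolved_approx:
  assumes J: "finite J" and S: "S \<in> row_supports M L" and T: "T \<subseteq> S" and c: "0 \<le> c" "c \<le> 1"
  shows "\<bar>expct J (\<lambda>X R. of_bool (\<forall>a\<in>T. \<not> (\<exists>j\<in>J. a \<in> R j \<and> R j \<subseteq> positive S X R)))
      - (p * rho M L (card T) + (1 - p) * (1 - c)) ^ card J\<bar>
    \<le> real (card J) * expct J (\<lambda>X R. \<bar>hit_within M L (card T) (card (positive S X R)) - c\<bar>)"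
proof -
  have TM: "T \<subseteq> {..<M}" using S T by (auto simp: row_supports_def)
  have pos: "positive S X (restrict R X) = positive S X R" for X R
    unfolding positive_def by simp
  define q where "q X R = hit_within M L (card T) (card (positive S X R))" for X R
  have avg_q: "avg (row_supports M L) (\<lambda>r. of_bool (r \<inter> T \<noteq> {} \<and> r \<subseteq> positive S X R)) = q X R"
    if "X \<subseteq> J" "R \<in> J \<rightarrow>\<^sub>E row_supports M L" for X R
    unfolding q_def using positive_bounds[OF S that] T
    by (intro avg_rows_hit_within) (auto simp: positive_def)
  have q01: "0 \<le> q X R" "q X R \<le> 1" if "X \<subseteq> J" "R \<in> J \<rightarrow>\<^sub>E row_supports M L" for X R
  proof -
    have "avg (row_supports M L) (\<lambda>r. 0) \<le> q X R" "q X R \<le> avg (row_supports M L) (\<lambda>r. 1)"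
      unfolding avg_q[OF that, symmetric] by (intro avg_mono; simp)+
    then show "0 \<le> q X R" "q X R \<le> 1" by (simp_all add: avg1)
  qed
  define av where "av X R = (of_bool (\<forall>j\<in>X. R j \<inter> T = {}) :: real)" for X and R :: "nat \<Rightarrow> nat set"
  have av: "av X (restrict R X) = av X R" for X R unfolding av_def by simp
  have "expct J (\<lambda>X R. of_bool (\<forall>a\<in>T. \<not> (\<exists>j\<in>J. a \<in> R j \<and> R j \<subseteq> positive S X R)))
    = expct J (\<lambda>X R. av X (restrict R X) *
        (\<Prod>j\<in>J - X. of_bool (\<not> (R j \<inter> T \<noteq> {} \<and> R j \<subseteq> positive S X (restrict R X)))))"
  proof (rule expct_cong)
    fix X R assume X: "X \<subseteq> J"
    \<comment> \<open>Rows of active items consist of positive tests automatically, so for them only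
      disjointness from \<open>T\<close> remains.\<close>
    have "R j \<subseteq> positive S X R" if "j \<in> X" for j
      unfolding positive_def using that by auto
    then have "(\<forall>a\<in>T. \<not> (\<exists>j\<in>J. a \<in> R j \<and> R j \<subseteq> positive S X R))
      \<longleftrightarrow> (\<forall>j\<in>X. R j \<inter> T = {}) \<and> (\<forall>j\<in>J - X. \<not> (R j \<inter> T \<noteq> {} \<and> R j \<subseteq> positive S X R))"
      using X by blast
    then show "of_bool (\<forall>a\<in>T. \<not> (\<exists>j\<in>J. a \<in> R j \<and> R j \<subseteq> positive S X R)) = av X (restrict R X) *
        (\<Prod>j\<in>J - X. of_bool (\<not> (R j \<inter> T \<noteq> {} \<and> R j \<subseteq> positive S X (restrict R X))))"
      unfolding pos av unfolding av_def of_bool_ball[OF finite_Diff[OF J], symmetric] of_bool_conj[symmetric]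
      by (simp only:)
  qed
  also have "\<dots> = expct J (\<lambda>X R. av X (restrict R X) * avg (row_supports M L)
        (\<lambda>r. of_bool (\<not> (r \<inter> T \<noteq> {} \<and> r \<subseteq> positive S X (restrict R X)))) ^ card (J - X))"
    by (rule expct_integrate_inactive[OF J, where g = "\<lambda>X R r. of_bool (\<not> (r \<inter> T \<noteq> {} \<and> r \<subseteq> positive S X R))"])
  also have "\<dots> = expct J (\<lambda>X R. av X R * (1 - q X R) ^ card (J - X))"
  proof (rule expct_cong)
    fix X R assume XR: "X \<subseteq> J" "R \<in> J \<rightarrow>\<^sub>E row_supports M L"
    have "avg (row_supports M L) (\<lambda>r. of_bool (\<not> (r \<inter> T \<noteq> {} \<and> r \<subseteq> positive S X R))) = 1 - q X R"
      unfolding of_bool_not_iff avg_diff avg1 avg_q[OF XR] ..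
    then show "av X (restrict R X) * avg (row_supports M L)
        (\<lambda>r. of_bool (\<not> (r \<inter> T \<noteq> {} \<and> r \<subseteq> positive S X (restrict R X)))) ^ card (J - X)
        = av X R * (1 - q X R) ^ card (J - X)"
      unfolding pos av by (simp only:)
  qed
  finally have 1: "expct J (\<lambda>X R. of_bool (\<forall>a\<in>T. \<not> (\<exists>j\<in>J. a \<in> R j \<and> R j \<subseteq> positive S X R)))
    = expct J (\<lambda>X R. av X R * (1 - q X R) ^ card (J - X))" .
  have 2: "(p * rho M L (card T) + (1 - p) * (1 - c)) ^ card J = expct J (\<lambda>X R. av X R * (1 - c) ^ card (J - X))"
    unfolding av_def using expct_avoid_weighted[OF J TM, of "1 - c"] by simp
  have ptw: "\<bar>av X R * (1 - q X R) ^ card (J - X) - av X R * (1 - c) ^ card (J - X)\<bar>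
    \<le> real (card J) * \<bar>q X R - c\<bar>" if XR: "X \<subseteq> J" "R \<in> J \<rightarrow>\<^sub>E row_supports M L" for X R
  proof -
    have "\<bar>av X R * (1 - q X R) ^ card (J - X) - av X R * (1 - c) ^ card (J - X)\<bar>
      = \<bar>av X R\<bar> * \<bar>(1 - q X R) ^ card (J - X) - (1 - c) ^ card (J - X)\<bar>"
      by (simp add: abs_mult[symmetric] right_diff_distrib)
    also have "\<dots> \<le> 1 * \<bar>(1 - q X R) ^ card (J - X) - (1 - c) ^ card (J - X)\<bar>"
      by (intro mult_right_mono) (auto simp: av_def)
    also have "\<dots> \<le> real (card (J - X)) * \<bar>(1 - q X R) - (1 - c)\<bar>"
      using norm_power_diff[of "1 - q X R" "1 - c" "card (J - X)"] q01[OF XR] c by simp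
    also have "\<dots> \<le> real (card J) * \<bar>q X R - c\<bar>"
      using J by (intro mult_mono) (auto intro: card_mono simp: abs_minus_commute)
    finally show ?thesis .
  qed
  have "expct J (\<lambda>X R. av X R * (1 - q X R) ^ card (J - X)) - expct J (\<lambda>X R. av X R * (1 - c) ^ card (J - X))
     \<le> expct J (\<lambda>X R. real (card J) * \<bar>q X R - c\<bar>)"
    unfolding expct_diff[symmetric] using ptw by (intro expct_mono) (simp add: abs_le_iff)
  moreover have "expct J (\<lambda>X R. av X R * (1 - c) ^ card (J - X)) - expct J (\<lambda>X R. av X R * (1 - q X R) ^ card (J - X))
     \<le> expct J (\<lambda>X R. real (card J) * \<bar>q X R - c\<bar>)"
    unfolding expct_diff[symmetric] using ptw by (intro expct_mono) (simp add: abs_le_iff)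
  ultimately show ?thesis
    unfolding 1 2 expct_cmult q_def[symmetric] by (simp add: abs_le_iff)
qed

text \<open>A test is negative iff it lies outside \<open>S\<close> and no active row hits it. The
  \<open>M - L\<close> candidates are counted by indicators; single tests and pairs of distinct
  tests lead to \<open>avoid\<close> at 1 and at 2. The reference value \<open>v\<close> is
  arbitrary here.\<close>

lemma expct_positive_variance:
  assumes J: "finite J" and S: "S \<in> row_supports M L" and M: "0 < M"
  shows "expct J (\<lambda>X R. (real (card (positive S X R)) / real M - (1 - v))\<^sup>2)
    = v\<^sup>2 - 2 * v * ((real M - real L) / real M) * avoid (card J) 1
      + (real M - real L) / real M * (avoid (card J) 1 / real M)
      + (real M - real L) / real M * ((real M - real L - 1) / real M) * avoid (card J) 2"
proof -
  have S': "S \<subseteq> {..<M}" "card S = L" "finite S"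
    using S by (auto simp: row_supports_def finite_subset)
  define B where "B = {..<M} - S"
  have B: "finite B" "card B = M - L" "real (card B) = real M - real L"
    unfolding B_def using S' L_le_M by (auto simp: card_Diff_subset)
  define u where "u a X R = (of_bool (a \<notin> (\<Union>j\<in>X. R j)) :: real)" for a :: nat and X :: "nat set" and R :: "nat \<Rightarrow> nat set"
  have Eu: "expct J (u a) = avoid (card J) 1" if "a \<in> B" for a
    unfolding u_def using expct_avoid[OF J, of "{a}"] that by (simp add: B_def)
  have Euu: "expct J (\<lambda>X R. u a X R * u b X R) = (if a = b then avoid (card J) 1 else avoid (card J) 2)"
    if "a \<in> B" "b \<in> B" for a b
  proof -
    have "expct J (\<lambda>X R. u a X R * u b X R) = expct J (\<lambda>X R. of_bool (\<forall>x\<in>{a,b}. x \<notin> (\<Union>j\<in>X. R j)))"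
      unfolding u_def by (intro expct_cong) auto
    also have "\<dots> = avoid (card J) (card {a,b})"
      using that by (intro expct_avoid J) (auto simp: B_def)
    finally show ?thesis by (auto simp: numeral_2_eq_2)
  qed
  have "expct J (\<lambda>X R. (real (card (positive S X R)) / real M - (1 - v))\<^sup>2)
    = expct J (\<lambda>X R. v\<^sup>2 + (- 2 * v / real M) * (\<Sum>a\<in>B. u a X R) + (1 / real M ^ 2) * (\<Sum>a\<in>B. \<Sum>b\<in>B. u a X R * u b X R))"
  proof (rule expct_cong)
    fix X R assume XR: "X \<subseteq> J" "R \<in> J \<rightarrow>\<^sub>E row_supports M L"
    have "{..<M} - positive S X R = {a \<in> B. a \<notin> (\<Union>j\<in>X. R j)}"
      unfolding B_def positive_def by auto
    then have "M - card (positive S X R) = card {a \<in> B. a \<notin> (\<Union>j\<in>X. R j)}"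
      using positive_bounds[OF S XR] card_Diff_subset[of "positive S X R" "{..<M}"] by simp
    then have "real M - real (card (positive S X R)) = (\<Sum>a\<in>B. u a X R)"
      unfolding u_def using positive_bounds(3)[OF S XR] B(1)
      by (simp add: of_nat_diff[symmetric] Int_def)
    then have e: "real (card (positive S X R)) = real M - (\<Sum>a\<in>B. u a X R)" by simp
    have "real (card (positive S X R)) / real M - (1 - v) = v - (\<Sum>a\<in>B. u a X R) / real M"
      unfolding e using M by (simp add: diff_divide_distrib)
    also have "\<dots>\<^sup>2 = v\<^sup>2 + (- 2 * v / real M) * (\<Sum>a\<in>B. u a X R) + (1 / real M ^ 2) * ((\<Sum>a\<in>B. u a X R) * (\<Sum>a\<in>B. u a X R))"
      by (simp add: power2_eq_square algebra_simps)
    finally show "(real (card (positive S X R)) / real M - (1 - v))\<^sup>2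
      = v\<^sup>2 + (- 2 * v / real M) * (\<Sum>a\<in>B. u a X R) + (1 / real M ^ 2) * (\<Sum>a\<in>B. \<Sum>b\<in>B. u a X R * u b X R)"
      by (simp add: sum_product)
  qed
  also have "\<dots> = v\<^sup>2 + (- 2 * v / real M) * (\<Sum>a\<in>B. expct J (u a))
      + (1 / real M ^ 2) * (\<Sum>a\<in>B. \<Sum>b\<in>B. expct J (\<lambda>X R. u a X R * u b X R))"
    unfolding expct_add expct_cmult expct_sum expct_const[OF J] ..
  also have "(\<Sum>a\<in>B. expct J (u a)) = (real M - real L) * avoid (card J) 1"
    using Eu B by simp
  also have "(\<Sum>a\<in>B. \<Sum>b\<in>B. expct J (\<lambda>X R. u a X R * u b X R))
     = (\<Sum>a\<in>B. \<Sum>b\<in>B. if a = b then avoid (card J) 1 else avoid (card J) 2)"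
    using Euu by (intro sum.cong) auto
  also have "\<dots> = (real M - real L) * avoid (card J) 1 + (real M - real L) * (real M - real L - 1) * avoid (card J) 2"
    unfolding sum_distinct_pairs[OF B(1)] B(3) ..
  finally have E: "expct J (\<lambda>X R. (real (card (positive S X R)) / real M - (1 - v))\<^sup>2)
    = v\<^sup>2 + (- 2 * v / real M) * ((real M - real L) * avoid (card J) 1)
      + (1 / real M ^ 2) * ((real M - real L) * avoid (card J) 1 + (real M - real L) * (real M - real L - 1) * avoid (card J) 2)" .
  have "v\<^sup>2 + (- 2 * v / m) * (D * x) + (1 / m ^ 2) * (D * x + D * (D - 1) * y)
     = v\<^sup>2 - 2 * v * (D / m) * x + D / m * (x / m) + D / m * ((D - 1) / m) * y" for m D x y :: real
    by (simp add: power2_eq_square add_divide_distrib)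
  then show ?thesis unfolding E by (simp only:)
qed

lemma expct_positive_deviation:
  assumes J: "finite J" and S: "S \<in> row_supports M L" and M: "0 < M"
  shows "expct J (\<lambda>X R. \<bar>real (card (positive S X R)) / real M - (1 - v)\<bar>)
    \<le> sqrt (v\<^sup>2 - 2 * v * ((real M - real L) / real M) * avoid (card J) 1
      + (real M - real L) / real M * (avoid (card J) 1 / real M)
      + (real M - real L) / real M * ((real M - real L - 1) / real M) * avoid (card J) 2 + 1 / real M)"
  unfolding expct_positive_variance[OF assms, symmetric]
  using M by (intro expct_abs_le_sqrt[OF J]) simp

abbreviation unresolved_rate :: "real \<Rightarrow> nat \<Rightarrow> nat \<Rightarrow> real" where
  "unresolved_rate \<equiv> unresolved_prob M L p"

abbreviation unresolved_error :: "real \<Rightarrow> nat \<Rightarrow> real" where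
  "unresolved_error \<equiv> unresolved_err M L p"

text \<open>Inclusion-exclusion over the tests of \<open>S\<close> in which every other item is a
  sure zero. The error for a subset \<open>T\<close> has a bound independent of \<open>T\<close>,
  and there are \<open>2 ^ L\<close> subsets.\<close>

lemma expct_all_unresolved_approx:
  assumes J: "finite J" and S: "S \<in> row_supports M L" and L: "0 < L"
    and M: "2 * L < M" "L * L \<le> M" and v: "0 \<le> v" "v \<le> 1"
  shows "\<bar>expct J (\<lambda>X R. of_bool (\<forall>a\<in>S. \<exists>j\<in>J. a \<in> R j \<and> R j \<subseteq> positive S X R))
     - (\<Sum>t\<le>L. real (L choose t) * ((-1) ^ t * unresolved_rate v (card J) t))\<bar>
    \<le> 2 ^ L * unresolved_error v (card J)"
proof -
  have S': "S \<subseteq> {..<M}" "card S = L" "finite S"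
    using S by (auto simp: row_supports_def finite_subset)
  define Q where "Q T = expct J (\<lambda>X R. of_bool (\<forall>a\<in>T. \<not> (\<exists>j\<in>J. a \<in> R j \<and> R j \<subseteq> positive S X R)))" for T
  have bound: "\<bar>Q T - unresolved_rate v (card J) (card T)\<bar> \<le> unresolved_error v (card J)" if T: "T \<subseteq> S" for T
  proof -
    have tL: "card T \<le> L" using T S' card_mono by auto
    define c where "c = real (card T) * real L * (1 - v) ^ (L - 1) / real M"
    \<comment> \<open>The hypothesis \<open>L * L <= M\<close> makes \<open>c\<close> at most 1, as
      \<open>expct_unresolved_approx\<close> requires.\<close>
    have "real (card T) * real L * (1 - v) ^ (L - 1) \<le> real L * real L * 1"
      using tL v by (intro mult_mono power_le_one) auto
    also have "\<dots> \<le> real M" using M(2) by (metis mult.right_neutral of_nat_le_iff of_nat_mult)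
    finally have c: "0 \<le> c" "c \<le> 1" unfolding c_def using v M by auto
    have "\<bar>Q T - unresolved_rate v (card J) (card T)\<bar>
      \<le> real (card J) * expct J (\<lambda>X R. \<bar>hit_within M L (card T) (card (positive S X R)) - c\<bar>)"
      unfolding Q_def unresolved_prob_def c_def[symmetric] by (rule expct_unresolved_approx[OF J S T c])
    also have "\<dots> \<le> real (card J) * expct J (\<lambda>X R. (real L ^ 3 / real M) *
        (3 * real L / (real M - real L) + \<bar>real (card (positive S X R)) / real M - (1 - v)\<bar>))"
    proof (intro mult_left_mono expct_mono)
      fix X R assume XR: "X \<subseteq> J" "R \<in> J \<rightarrow>\<^sub>E row_supports M L"
      show "\<bar>hit_within M L (card T) (card (positive S X R)) - c\<bar> \<le> (real L ^ 3 / real M) *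
        (3 * real L / (real M - real L) + \<bar>real (card (positive S X R)) / real M - (1 - v)\<bar>)"
        unfolding c_def using positive_bounds[OF S XR] tL M L v
        by (intro hit_within_approx) auto
    qed auto
    also have "\<dots> = real (card J) / real M * real L ^ 3 * (3 * real L / (real M - real L)
       + expct J (\<lambda>X R. \<bar>real (card (positive S X R)) / real M - (1 - v)\<bar>))"
      unfolding expct_cmult expct_add expct_const[OF J] by simp
    also have "\<dots> \<le> unresolved_error v (card J)"
      unfolding unresolved_err_def
      using M by (intro mult_left_mono add_left_mono expct_positive_deviation J S) auto
    finally show ?thesis .
  qed
  have "expct J (\<lambda>X R. of_bool (\<forall>a\<in>S. \<exists>j\<in>J. a \<in> R j \<and> R j \<subseteq> positive S X R))
    = expct J (\<lambda>X R. of_bool (\<forall>a\<in>S. \<not> (\<not> (\<exists>j\<in>J. a \<in> R j \<and> R j \<subseteq> positive S X R))))"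
    by simp
  also have "\<dots> = (\<Sum>T\<in>Pow S. (-1) ^ card T * Q T)"
    unfolding expct_inclusion_exclusion[OF S'(3)] Q_def ..
  finally have 1: "expct J (\<lambda>X R. of_bool (\<forall>a\<in>S. \<exists>j\<in>J. a \<in> R j \<and> R j \<subseteq> positive S X R))
    = (\<Sum>T\<in>Pow S. (-1) ^ card T * Q T)" .
  have 2: "(\<Sum>t\<le>L. real (L choose t) * ((-1) ^ t * unresolved_rate v (card J) t))
    = (\<Sum>T\<in>Pow S. (-1) ^ card T * unresolved_rate v (card J) (card T))"
    using sum_Pow_card[OF S'(3), of "\<lambda>t. (-1) ^ t * unresolved_rate v (card J) t"] S' by simp
  have "\<bar>(\<Sum>T\<in>Pow S. (-1) ^ card T * Q T) - (\<Sum>T\<in>Pow S. (-1) ^ card T * unresolved_rate v (card J) (card T))\<bar>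
    = \<bar>\<Sum>T\<in>Pow S. (-1) ^ card T * (Q T - unresolved_rate v (card J) (card T))\<bar>"
    by (simp add: sum_subtractf algebra_simps)
  also have "\<dots> \<le> (\<Sum>T\<in>Pow S. \<bar>(-1) ^ card T * (Q T - unresolved_rate v (card J) (card T))\<bar>)"
    by (rule sum_abs)
  also have "\<dots> \<le> (\<Sum>T\<in>Pow S. unresolved_error v (card J))"
    using bound by (intro sum_mono) (auto simp: abs_mult power_abs)
  also have "\<dots> = 2 ^ L * unresolved_error v (card J)"
    using S' by (simp add: card_Pow)
  finally show ?thesis unfolding 1 2 .
qed

end

section \<open>The expected cost\<close>

text \<open>Families in \<open>PiE\<close> are \<open>undefined\<close> outside
  \<open>{..<N}\<close>; the guard \<open>i < N\<close> keeps those values out of the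
  matrix.\<close>

definition incidence :: "nat \<Rightarrow> (nat \<Rightarrow> nat set) \<Rightarrow> nat \<Rightarrow> nat \<Rightarrow> bool" where
  "incidence N R i a \<longleftrightarrow> i < N \<and> a \<in> R i"

lemma finite_matrices: "finite (matrices N M)"
proof (rule finite_imageD)
  show "finite ((\<lambda>C. {(i, a). C i a}) ` matrices N M)"
    by (rule finite_subset[of _ "Pow ({..<N} \<times> {..<M})"]) (auto simp: matrices_def)
  show "inj_on (\<lambda>C. {(i, a). C i a}) (matrices N M)"
    by (auto simp: inj_on_def set_eq_iff fun_eq_iff)
qed

text \<open>Matrices whose rows have \<open>L\<close> ones correspond bijectively to families of row
  supports, and all of them carry the same weight.\<close>

lemma sum_P_RP:
  "(\<Sum>C\<in>matrices N M. P_RP N M L C * F C) = avg ({..<N} \<rightarrow>\<^sub>E row_supports M L) (\<lambda>R. F (incidence N R))"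
proof -
  define G where "G = {C \<in> matrices N M. \<forall>i<N. card {a. a < M \<and> C i a} = L}"
  have "(\<Sum>C\<in>matrices N M. P_RP N M L C * F C) = (\<Sum>C\<in>G. F C / real (M choose L) ^ N)"
    unfolding G_def
    by (intro sum.mono_neutral_cong_right finite_matrices) (auto simp: P_RP_def)
  also have "\<dots> = (\<Sum>R\<in>{..<N} \<rightarrow>\<^sub>E row_supports M L. F (incidence N R) / real (M choose L) ^ N)"
  proof (rule sum.reindex_bij_witness[of _ "incidence N" "\<lambda>C. restrict (\<lambda>i. {a. a < M \<and> C i a}) {..<N}"])
    fix C assume C: "C \<in> G"
    show "incidence N (restrict (\<lambda>i. {a. a < M \<and> C i a}) {..<N}) = C"
      using C by (auto simp: G_def matrices_def incidence_def fun_eq_iff)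
    then show "F (incidence N (restrict (\<lambda>i. {a. a < M \<and> C i a}) {..<N})) / real (M choose L) ^ N = F C / real (M choose L) ^ N"
      by simp
    show "restrict (\<lambda>i. {a. a < M \<and> C i a}) {..<N} \<in> {..<N} \<rightarrow>\<^sub>E row_supports M L"
      using C by (auto simp: G_def row_supports_def)
  next
    fix R assume R: "R \<in> {..<N} \<rightarrow>\<^sub>E row_supports M L"
    have *: "{a. a < M \<and> incidence N R i a} = R i" if "i < N" for i
      using R that PiE_mem[OF R, of i] by (auto simp: incidence_def row_supports_def)
    show "restrict (\<lambda>i. {a. a < M \<and> incidence N R i a}) {..<N} = R"
      using PiE_arb[OF R] by (intro ext) (simp add: * restrict_def)
    have "R i \<subseteq> {..<M}" "card (R i) = L" if "i < N" for i
      using PiE_mem[OF R, of i] that by (simp_all add: row_supports_def)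
    then show "incidence N R \<in> G"
      unfolding G_def by (simp add: * matrices_def) (auto simp: incidence_def)
  qed
  also have "\<dots> = avg ({..<N} \<rightarrow>\<^sub>E row_supports M L) (\<lambda>R. F (incidence N R))"
    unfolding avg_def by (simp add: card_PiE card_rows sum_divide_distrib)
  finally show ?thesis .
qed

text \<open>A test is negative exactly when no active row contains it, so an item fails to be a sure
  zero iff the active rows cover its row.\<close>

lemma sure_zero_incidence:
  assumes "X \<subseteq> {..<N}" "R \<in> {..<N} \<rightarrow>\<^sub>E row_supports M L" "i < N"
  shows "sure_zero N M (incidence N R) X i \<longleftrightarrow> \<not> R i \<subseteq> (\<Union>j\<in>X. R j)"
proof -
  have "\<forall>a\<in>R i. a < M"
    using assms(3) PiE_mem[OF assms(2), of i] by (auto simp: row_supports_def)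
  moreover have "\<forall>j\<in>X. j < N" using assms(1) by auto
  ultimately show ?thesis
    using assms(3) unfolding sure_zero_def test_outcome_def incidence_def by blast
qed

lemma card_others: "i < N \<Longrightarrow> card ({..<N} - {i}) = N - 1"
  by simp

lemma mem_U0_incidence:
  assumes "X \<subseteq> {..<N}" "R \<in> {..<N} \<rightarrow>\<^sub>E row_supports M L" "i < N"
  shows "i \<in> U0 N M (incidence N R) X \<longleftrightarrow> i \<notin> X \<and> R i \<subseteq> (\<Union>j\<in>X. R j)"
  using sure_zero_incidence[OF assms] assms(3) by (auto simp: U0_def)

lemma mem_U1_incidence:
  assumes "X \<subseteq> {..<N}" "R \<in> {..<N} \<rightarrow>\<^sub>E row_supports M L" "i < N"
  shows "i \<in> U1 N M (incidence N R) X
    \<longleftrightarrow> i \<in> X \<and> (\<forall>a\<in>R i. \<exists>j\<in>{..<N} - {i}. a \<in> R j \<and> R j \<subseteq> (\<Union>k\<in>X. R k))"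
proof -
  have "R i \<subseteq> {..<M}" using PiE_mem[OF assms(2), of i] assms(3) by (auto simp: row_supports_def)
  then have "sure_one N M (incidence N R) X i \<longleftrightarrow>
     i \<in> X \<and> (\<exists>a\<in>R i. \<forall>j\<in>{..<N} - {i}. a \<in> R j \<longrightarrow> sure_zero N M (incidence N R) X j)"
    using assms(3) unfolding sure_one_def incidence_def by fastforce
  also have "\<dots> \<longleftrightarrow> i \<in> X \<and> (\<exists>a\<in>R i. \<forall>j\<in>{..<N} - {i}. a \<in> R j \<longrightarrow> \<not> R j \<subseteq> (\<Union>k\<in>X. R k))"
    using sure_zero_incidence[OF assms(1,2)] by auto
  finally show ?thesis using assms(3) unfolding U1_def by auto
qed

section \<open>Linearity of the expected cost over items\<close>

context pooling
begin

text \<open>The conditional probability, given that \<open>i\<close> is inactive, that it is not a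
  sure zero. The analogue \<open>missed_one\<close> conditions on \<open>i\<close> being active, so
  that its own row \<open>S\<close> adds to the positive tests.\<close>

definition missed_zero :: "nat \<Rightarrow> nat \<Rightarrow> real" where
  "missed_zero N i = avg (row_supports M L) (\<lambda>S. expct ({..<N} - {i}) (\<lambda>X R. of_bool (S \<subseteq> (\<Union>j\<in>X. R j))))"

definition missed_one :: "nat \<Rightarrow> nat \<Rightarrow> real" where
  "missed_one N i = avg (row_supports M L) (\<lambda>S. expct ({..<N} - {i})
     (\<lambda>X R. of_bool (\<forall>a\<in>S. \<exists>j\<in>{..<N} - {i}. a \<in> R j \<and> R j \<subseteq> positive S X R)))"

lemma expected_Tcost:
  "(\<Sum>C\<in>matrices N M. P_RP N M L C * Tcost N M C p)
    = real M + (\<Sum>i<N. (1 - p) * missed_zero N i + p * missed_one N i)"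
proof -
  let ?D = "{..<N} \<rightarrow>\<^sub>E row_supports M L"
  have cU: "real (card (U0 N M C X) + card (U1 N M C X))
     = (\<Sum>i<N. of_bool (i \<in> U0 N M C X) + of_bool (i \<in> U1 N M C X))" for C X
  proof -
    have "{..<N} \<inter> U0 N M C X = U0 N M C X" "{..<N} \<inter> U1 N M C X = U1 N M C X"
      by (auto simp: U0_def U1_def)
    then show ?thesis by (simp add: sum.distrib)
  qed
  have "(\<Sum>C\<in>matrices N M. P_RP N M L C * Tcost N M C p)
     = avg ?D (\<lambda>R. real M + (\<Sum>X\<in>Pow {..<N}. p ^ card X * (1 - p) ^ card ({..<N} - X) *
         (\<Sum>i<N. of_bool (i \<in> U0 N M (incidence N R) X) + of_bool (i \<in> U1 N M (incidence N R) X))))"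
    unfolding sum_P_RP Tcost_def configs_def mu_def cU
    by (intro avg_cong arg_cong2[where f = "(+)"] sum.cong)
       (auto simp: card_Diff_subset finite_subset)
  also have "\<dots> = real M + expct {..<N} (\<lambda>X R. \<Sum>i<N. of_bool (i \<in> U0 N M (incidence N R) X) + of_bool (i \<in> U1 N M (incidence N R) X))"
    unfolding expct_def avg_add avg_sum avg_cmult
    by (simp add: avg_const finite_PiE finite_rows PiE_eq_empty_iff rows_nonempty)
  also have "\<dots> = real M + (\<Sum>i<N. expct {..<N} (\<lambda>X R. of_bool (i \<in> U0 N M (incidence N R) X) + of_bool (i \<in> U1 N M (incidence N R) X)))"
    unfolding expct_sum ..
  also have "(\<Sum>i<N. expct {..<N} (\<lambda>X R. of_bool (i \<in> U0 N M (incidence N R) X) + of_bool (i \<in> U1 N M (incidence N R) X)))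
     = (\<Sum>i<N. (1 - p) * missed_zero N i + p * missed_one N i)"
  proof (intro sum.cong refl)
    fix i assume i: "i \<in> {..<N}"
    define J where "J = {..<N} - {i}"
    have J: "finite J" "i \<notin> J" "{..<N} = insert i J" unfolding J_def using i by auto
    let ?h = "\<lambda>X R. of_bool (i \<in> U0 N M (incidence N R) X) + of_bool (i \<in> U1 N M (incidence N R) X) :: real"
    have "expct {..<N} ?h = avg (row_supports M L) (\<lambda>S. p * expct J (\<lambda>X R. ?h (insert i X) (R(i := S)))
       + (1 - p) * expct J (\<lambda>X R. ?h X (R(i := S))))"
      unfolding J(3) by (rule expct_insert[OF J(1,2)])
    \<comment> \<open>An active \<open>i\<close> can lie only in \<open>U1\<close> and an inactive
      one only in \<open>U0\<close>, so one indicator drops out in each branch.\<close>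
    also have "\<dots> = avg (row_supports M L) (\<lambda>S.
         p * expct J (\<lambda>X R. of_bool (\<forall>a\<in>S. \<exists>j\<in>J. a \<in> R j \<and> R j \<subseteq> positive S X R))
       + (1 - p) * expct J (\<lambda>X R. of_bool (S \<subseteq> (\<Union>j\<in>X. R j))))"
    proof (intro avg_cong arg_cong2[where f = "(+)"] arg_cong2[where f = "(*)"] refl expct_cong)
      fix S X R assume S: "S \<in> row_supports M L" and X: "X \<subseteq> J" and R: "R \<in> J \<rightarrow>\<^sub>E row_supports M L"
      have R': "R(i := S) \<in> {..<N} \<rightarrow>\<^sub>E row_supports M L"
        unfolding J(3) using R S J by (auto simp: PiE_iff extensional_def)
      have X': "X \<subseteq> {..<N}" "insert i X \<subseteq> {..<N}" "i < N" "i \<notin> X" using X i J by auto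
      have un: "(\<Union>j\<in>X. (R(i := S)) j) = (\<Union>j\<in>X. R j)" using X' by auto
      have pos: "(\<Union>j\<in>insert i X. (R(i := S)) j) = positive S X R"
        using X' by (auto simp: positive_def split: if_splits)
      have all: "(\<forall>a\<in>S. \<exists>j\<in>J. a \<in> (R(i := S)) j \<and> (R(i := S)) j \<subseteq> V)
         \<longleftrightarrow> (\<forall>a\<in>S. \<exists>j\<in>J. a \<in> R j \<and> R j \<subseteq> V)" for V
        using J(2) by (intro ball_cong bex_cong refl) auto
      show "?h (insert i X) (R(i := S)) = of_bool (\<forall>a\<in>S. \<exists>j\<in>J. a \<in> R j \<and> R j \<subseteq> positive S X R)"
        unfolding mem_U0_incidence[OF X'(2) R' X'(3)] mem_U1_incidence[OF X'(2) R' X'(3)] pos J_def[symmetric]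
        using all[of "positive S X R"] by simp
      show "?h X (R(i := S)) = of_bool (S \<subseteq> (\<Union>j\<in>X. R j))"
        unfolding mem_U0_incidence[OF X'(1) R' X'(3)] mem_U1_incidence[OF X'(1) R' X'(3)] un using X' by simp
    qed
    also have "\<dots> = (1 - p) * missed_zero N i + p * missed_one N i"
      unfolding missed_zero_def missed_one_def J_def avg_add avg_cmult by simp
    finally show "expct {..<N} ?h = (1 - p) * missed_zero N i + p * missed_one N i" .
  qed
  finally show ?thesis .
qed

lemma missed_zero_nonneg: "0 \<le> missed_zero N i"
proof -
  have "avg (row_supports M L) (\<lambda>S. expct ({..<N} - {i}) (\<lambda>X R. 0)) \<le> missed_zero N i"
    unfolding missed_zero_def by (intro avg_mono expct_mono) auto
  then show ?thesis by (simp add: expct_const avg1)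
qed

lemma missed_one_bounds: "0 \<le> missed_one N i" "missed_one N i \<le> 1"
proof -
  have "avg (row_supports M L) (\<lambda>S. expct ({..<N} - {i}) (\<lambda>X R. 0)) \<le> missed_one N i"
    "missed_one N i \<le> avg (row_supports M L) (\<lambda>S. expct ({..<N} - {i}) (\<lambda>X R. 1))"
    unfolding missed_one_def by (intro avg_mono expct_mono; simp)+
  then show "0 \<le> missed_one N i" "missed_one N i \<le> 1" by (simp_all add: expct_const avg1)
qed

lemma missed_zero_eq:
  assumes "i < N"
  shows "missed_zero N i = (\<Sum>t\<le>L. real (L choose t) * ((-1) ^ t * avoid (N - 1) t))"
proof -
  have "missed_zero N i = avg (row_supports M L) (\<lambda>S. \<Sum>t\<le>L. real (L choose t) * ((-1) ^ t * avoid (N - 1) t))"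
    unfolding missed_zero_def
    using card_others[OF assms] expct_covered[of "{..<N} - {i}"] by (intro avg_cong) auto
  then show ?thesis by (simp only: avg1)
qed

lemma missed_zero_le:
  assumes "i < N" "0 < L"
  shows "missed_zero N i \<le> real N * p * (real L ^ 4 / real M ^ 2) + (1 - exp (- (real N * (p * real L / real M)))) ^ L
       + 2 ^ L * (real N * (real L * (p * real L / real M))\<^sup>2)" (is "_ \<le> ?b")
proof -
  have "missed_zero N i \<le> avg (row_supports M L) (\<lambda>S. ?b)"
    unfolding missed_zero_def
    using card_others[OF assms(1)] assms(2) by (intro avg_mono expct_covered_le) auto
  then show ?thesis by (simp only: avg1)
qed

lemma missed_one_approx:
  assumes "i < N" "0 < L" "2 * L < M" "L * L \<le> M" "0 \<le> v" "v \<le> 1"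
  shows "\<bar>missed_one N i - (\<Sum>t\<le>L. real (L choose t) * ((-1) ^ t * unresolved_rate v (N - 1) t))\<bar>
    \<le> 2 ^ L * unresolved_error v (N - 1)"
proof -
  let ?s = "\<Sum>t\<le>L. real (L choose t) * ((-1) ^ t * unresolved_rate v (N - 1) t)"
  let ?e = "2 ^ L * unresolved_error v (N - 1)"
  have *: "\<bar>expct ({..<N} - {i}) (\<lambda>X R. of_bool (\<forall>a\<in>S. \<exists>j\<in>{..<N} - {i}. a \<in> R j \<and> R j \<subseteq> positive S X R)) - ?s\<bar> \<le> ?e"
    if "S \<in> row_supports M L" for S
    using expct_all_unresolved_approx[OF _ that assms(2-6), of "{..<N} - {i}"] card_others[OF assms(1)]
    by simp
  have "missed_one N i \<le> avg (row_supports M L) (\<lambda>S. ?s + ?e)"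
    "avg (row_supports M L) (\<lambda>S. ?s - ?e) \<le> missed_one N i"
    unfolding missed_one_def using * by (intro avg_mono; fastforce simp: abs_le_iff)+
  then show ?thesis unfolding avg1 by linarith
qed

end

section \<open>A uniform bound for the normalised cost\<close>

lemma avg_cost_eq:
  assumes "Lbar p \<le> Mbar N p" "0 \<le> p" "p \<le> 1"
  shows "avg_cost N p = (real (Mbar N p) + (\<Sum>i<N. (1 - p) * pooling.missed_zero (Mbar N p) (Lbar p) p N i
     + p * pooling.missed_one (Mbar N p) (Lbar p) p N i)) / (real N * p * \<bar>ln p\<bar>)"
proof -
  interpret pooling "Mbar N p" "Lbar p" p using assms by unfold_locales
  show ?thesis
    unfolding avg_cost_def expected_Tcost[symmetric] by (simp add: sum_divide_distrib)
qed

text \<open>\<open>Lbar p\<close> is the integer part of the binary logarithm of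
  \<open>1 / p\<close>, so \<open>2 ^ Lbar p\<close> agrees with \<open>1 / p\<close> up to a factor
  of 2.\<close>

lemma Lbar_bounds:
  assumes "0 < p" "p \<le> 1/2"
  shows "ln 2 \<le> \<bar>ln p\<bar>" "1 \<le> Lbar p" "real (Lbar p) * ln 2 \<le> \<bar>ln p\<bar>"
    "2 ^ Lbar p \<le> 1 / p" "1 / (2 * p) \<le> 2 ^ Lbar p"
proof -
  have "ln p \<le> ln (1/2)" using assms by (subst ln_le_cancel_iff) auto
  then have "ln 2 \<le> - ln p" by (simp add: ln_div)
  then have l: "\<bar>ln p\<bar> = - ln p" "ln 2 \<le> - ln p" using ln2_ge_two_thirds by linarith+
  then show l2: "ln 2 \<le> \<bar>ln p\<bar>" by simp
  have q: "1 \<le> \<bar>ln p\<bar> / ln 2" using l2 by simp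
  have fl: "real (Lbar p) = real_of_int \<lfloor>\<bar>ln p\<bar> / ln 2\<rfloor>"
    unfolding Lbar_def using q by (simp add: le_floor_iff)
  show "1 \<le> Lbar p" unfolding Lbar_def using q by (simp add: le_nat_iff le_floor_iff)
  have up: "real (Lbar p) \<le> \<bar>ln p\<bar> / ln 2" unfolding fl by (rule of_int_floor_le)
  then show ub: "real (Lbar p) * ln 2 \<le> \<bar>ln p\<bar>" by (simp add: field_simps)
  have "\<bar>ln p\<bar> / ln 2 \<le> real (Lbar p) + 1" unfolding fl by linarith
  then have lb: "\<bar>ln p\<bar> \<le> real (Suc (Lbar p)) * ln 2" by (simp add: field_simps)
  have pw: "(2::real) ^ k = exp (real k * ln 2)" for k by (simp add: exp_of_nat_mult)
  have ep: "exp \<bar>ln p\<bar> = 1 / p" unfolding l(1) using assms by (simp add: exp_minus inverse_eq_divide)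
  show "2 ^ Lbar p \<le> 1 / p" unfolding pw ep[symmetric] using ub by simp
  have "1 / p \<le> 2 ^ Suc (Lbar p)" unfolding pw ep[symmetric] using lb by simp
  then show "1 / (2 * p) \<le> 2 ^ Lbar p" using assms by (simp add: field_simps)
qed

text \<open>Supplies the factor 2 that keeps the number of tests above \<open>N * p * |ln p|\<close>
  in spite of rounding down.\<close>

lemma ln2_sq_le_half: "(ln 2)\<^sup>2 \<le> (1/2 :: real)"
proof -
  have "ln (2::real) \<le> 25/36" using ln2_le_25_over_36 by simp
  then have "(ln (2::real))\<^sup>2 \<le> (25/36)\<^sup>2" by (intro power_mono) auto
  also have "\<dots> \<le> 1/2" by (simp add: power2_eq_square)
  finally show ?thesis .
qed

text \<open>At \<open>x = ln 2\<close> the base is exactly \<open>1 / 2\<close>. The integer part in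
  \<open>Mbar\<close> can raise \<open>x\<close> by a relative amount of \<open>1 / M\<close>, which
  multiplies the base by at most \<open>exp (1 / M)\<close>; over \<open>L <= M\<close> factors this
  costs at most \<open>exp 1 <= 3\<close>.\<close>

lemma covering_power_le:
  assumes L: "L \<le> M" "0 < M" and x: "x \<le> ln 2 * (1 + 1 / real M)" "0 \<le> x"
  shows "(1 - exp (- x)) ^ L \<le> 3 / 2 ^ L"
proof -
  have "exp (- (ln 2 * (1 + 1 / real M))) \<le> exp (- x)" using x by simp
  also have "exp (- (ln 2 * (1 + 1 / real M))) = (1/2) * exp (- (ln 2 / real M))"
    by (simp add: distrib_left exp_add exp_minus field_simps exp_diff)
  finally have "(1/2) * (1 - ln 2 / real M) \<le> exp (- x)"
    using exp_ge_add_one_self[of "- (ln 2 / real M)"] by simp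
  moreover have "ln 2 / real M \<le> 1 / real M"
    using ln2_le_25_over_36 by (intro divide_right_mono) auto
  ultimately have "1 - exp (- x) \<le> (1 + 1 / real M) / 2" by argo
  also have "\<dots> \<le> exp (1 / real M) / 2" by (intro divide_right_mono exp_ge_add_one_self) simp
  finally have "(1 - exp (- x)) ^ L \<le> (exp (1 / real M) / 2) ^ L"
    using x by (intro power_mono) auto
  also have "\<dots> = exp (real L / real M) / 2 ^ L"
    by (simp add: power_divide exp_of_nat_mult[symmetric])
  also have "\<dots> \<le> exp 1 / 2 ^ L" using L by (intro divide_right_mono) auto
  also have "\<dots> \<le> 3 / 2 ^ L" using exp_le by (intro divide_right_mono) auto
  finally show ?thesis .
qed

text \<open>The first error stems from the integer part in \<open>Mbar\<close>. The second collects
  double hits and the exponential approximation, 16 from each. The third is \<open>6 * p\<close>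
  from the covering probability plus \<open>p\<close> from the trivial bound on missed active items,
  divided by \<open>p * |ln p|\<close>.\<close>

lemma avg_cost_approx:
  assumes p: "0 < p" "p \<le> 1/2" and Np: "2 \<le> real N * p"
  shows "\<bar>avg_cost N p - 1 / (ln 2)\<^sup>2\<bar>
    \<le> 1 / (real N * p * \<bar>ln p\<bar>) + 32 * \<bar>ln p\<bar> / (real N * p\<^sup>2) + 7 / \<bar>ln p\<bar>"
proof -
  define l where "l = \<bar>ln p\<bar>"
  define L where "L = Lbar p"
  define M where "M = Mbar N p"
  define y where "y = real N * p * l / (ln 2)\<^sup>2"
  have N: "0 < real N" using Np p by (cases N) auto
  note Lb = Lbar_bounds[OF p, folded l_def L_def]
  have l23: "2/3 \<le> l" using Lb(1) ln2_ge_two_thirds by linarith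
  have l0: "0 < l" using l23 by simp
  have L2l: "real L \<le> 2 * l"
  proof -
    have "real L * (2/3) \<le> real L * ln 2" using ln2_ge_two_thirds by (intro mult_left_mono) auto
    then show ?thesis using Lb(3) l0 by linarith
  qed
  have Npl: "4/3 \<le> real N * p * l"
    using mult_mono[OF Np l23] Np l23 by simp
  have y2: "2 * (real N * p * l) \<le> y"
  proof -
    have "2 * (real N * p * l) * (ln 2)\<^sup>2 \<le> 2 * (real N * p * l) * (1/2)"
      using Npl ln2_sq_le_half by (intro mult_left_mono) auto
    then show ?thesis unfolding y_def by (simp add: field_simps)
  qed
  have fl: "real M = real_of_int \<lfloor>y\<rfloor>"
    unfolding M_def Mbar_def y_def[symmetric] l_def[symmetric] using y2 Npl by simp
  have M1: "real M \<le> y" "y \<le> real M + 1" unfolding fl by linarith+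
  have MNpl: "real N * p * l \<le> real M" using M1 y2 Npl by linarith
  have M0: "0 < real M" using MNpl Npl by linarith
  have LM: "L \<le> M"
  proof -
    have "2 * l \<le> real N * p * l" using Np l0 by (intro mult_right_mono) auto
    then show ?thesis using L2l MNpl by linarith
  qed
  interpret pooling M L p using LM p by unfold_locales auto
  define b where "b = real N * p * (real L ^ 4 / real M ^ 2) + (1 - exp (- (real N * (p * real L / real M)))) ^ L
       + 2 ^ L * (real N * (real L * (p * real L / real M))\<^sup>2)"
  define E where "E = (\<Sum>i<N. (1 - p) * missed_zero N i + p * missed_one N i)"
  \<comment> \<open>The square of this ratio governs both \<open>b1\<close> and \<open>b3\<close>;
    the bound combines \<open>L <= 2 * l\<close> with \<open>M >= N * p * l\<close>.\<close>
  have LlM: "real L ^ 2 / real M \<le> 4 * l / (real N * p)"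
  proof -
    have "real L ^ 2 / real M \<le> (2 * l) ^ 2 / (real N * p * l)"
      using L2l MNpl Npl l0 by (intro frac_le power_mono) auto
    also have "\<dots> = 4 * l / (real N * p)" using l0 by (simp add: power2_eq_square)
    finally show ?thesis .
  qed
  have sq: "(real L ^ 2 / real M)\<^sup>2 \<le> (4 * l / (real N * p))\<^sup>2" using LlM by (intro power_mono) auto
  have b1: "real N * p * (real L ^ 4 / real M ^ 2) \<le> 16 * l\<^sup>2 / (real N * p)"
  proof -
    have "real N * p * (real L ^ 4 / real M ^ 2) = real N * p * (real L ^ 2 / real M)\<^sup>2"
      by (simp add: power_divide power_mult[symmetric])
    also have "\<dots> \<le> real N * p * (4 * l / (real N * p))\<^sup>2"
      using sq N p by (intro mult_left_mono) auto
    also have "\<dots> = 16 * l\<^sup>2 / (real N * p)"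
      using N p by (simp add: power2_eq_square)
    finally show ?thesis .
  qed
  have b3: "2 ^ L * (real N * (real L * (p * real L / real M))\<^sup>2) \<le> 16 * l\<^sup>2 / (real N * p)"
  proof -
    have "2 ^ L * (real N * (real L * (p * real L / real M))\<^sup>2) = 2 ^ L * (real N * p\<^sup>2 * (real L ^ 2 / real M)\<^sup>2)"
      by (simp add: power2_eq_square)
    also have "\<dots> \<le> (1 / p) * (real N * p\<^sup>2 * (4 * l / (real N * p))\<^sup>2)"
      using sq N p Lb(4) by (intro mult_mono mult_left_mono) auto
    also have "\<dots> = 16 * l\<^sup>2 / (real N * p)"
      using N p by (simp add: power2_eq_square)
    finally show ?thesis .
  qed
  have b2: "(1 - exp (- (real N * (p * real L / real M)))) ^ L \<le> 6 * p"
  proof -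
    \<comment> \<open>The factor \<open>1 / (ln 2)^2\<close> in \<open>Mbar\<close> and
      \<open>L * ln 2 <= l\<close> keep the exponent \<open>N * p * L / M\<close> below
      \<open>ln 2\<close> up to rounding.\<close>
    have "real N * p * (real L * ln 2) \<le> real N * p * l"
      using Lb(3) N p by (intro mult_left_mono) auto
    also have "\<dots> = y * (ln 2)\<^sup>2" unfolding y_def by simp
    finally have "real N * p * real L \<le> y * ln 2"
      by (simp add: power2_eq_square mult.assoc[symmetric])
    also have "\<dots> \<le> (real M + 1) * ln 2" using M1 by (intro mult_right_mono) auto
    finally have "real N * (p * real L / real M) \<le> ln 2 * (1 + 1 / real M)"
      using M0 by (simp add: field_simps)
    then have "(1 - exp (- (real N * (p * real L / real M)))) ^ L \<le> 3 / 2 ^ L"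
      using LM M0 p by (intro covering_power_le) auto
    also have "\<dots> \<le> 3 / (1 / (2 * p))" using Lb(5) p by (intro divide_left_mono) auto
    finally show ?thesis by simp
  qed
  have b: "b \<le> 32 * l\<^sup>2 / (real N * p) + 6 * p" proof -
    have "b \<le> 16 * l\<^sup>2 / (real N * p) + 6 * p + 16 * l\<^sup>2 / (real N * p)"
      unfolding b_def by (intro add_mono b1 b2 b3)
    also have "\<dots> = 32 * l\<^sup>2 / (real N * p) + 6 * p" by simp
    finally show ?thesis .
  qed
  have E0: "0 \<le> E"
    unfolding E_def using p missed_zero_nonneg missed_one_bounds(1)
    by (intro sum_nonneg add_nonneg_nonneg mult_nonneg_nonneg) auto
  have "E \<le> (\<Sum>i<N. b + p)"
    unfolding E_def
  proof (intro sum_mono add_mono)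
    fix i assume i: "i \<in> {..<N}"
    have "(1 - p) * missed_zero N i \<le> 1 * b"
      unfolding b_def using p i Lb(2) missed_zero_nonneg by (intro mult_mono missed_zero_le) auto
    then show "(1 - p) * missed_zero N i \<le> b" by simp
    show "p * missed_one N i \<le> p"
      using p missed_one_bounds(2) mult_left_mono[of "missed_one N i" 1 p] by simp
  qed
  also have "\<dots> \<le> real N * (32 * l\<^sup>2 / (real N * p) + 7 * p)"
    using b N by simp
  finally have "E / (real N * p * l) \<le> real N * (32 * l\<^sup>2 / (real N * p) + 7 * p) / (real N * p * l)"
    using N p l0 by (intro divide_right_mono) auto
  also have "\<dots> = 32 * l / (real N * p\<^sup>2) + 7 / l"
    using N p l0 by (simp add: field_simps power2_eq_square)
  finally have E1: "E / (real N * p * l) \<le> 32 * l / (real N * p\<^sup>2) + 7 / l" .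
  have E2: "0 \<le> E / (real N * p * l)" using E0 N p l0 by simp
  have yl: "y / (real N * p * l) = 1 / (ln 2)\<^sup>2" unfolding y_def using N p l0 by simp
  have "real M / (real N * p * l) \<le> y / (real N * p * l)"
    using M1 N p l0 by (intro divide_right_mono) auto
  moreover have "(y - 1) / (real N * p * l) \<le> real M / (real N * p * l)"
    using M1 N p l0 by (intro divide_right_mono) auto
  ultimately have M2: "real M / (real N * p * l) \<le> 1 / (ln 2)\<^sup>2"
      "1 / (ln 2)\<^sup>2 - 1 / (real N * p * l) \<le> real M / (real N * p * l)"
    unfolding diff_divide_distrib yl by auto
  have "avg_cost N p = (real M + E) / (real N * p * l)"
    using avg_cost_eq[of p N] LM p unfolding E_def M_def L_def l_def by simp
  then have T: "avg_cost N p = real M / (real N * p * l) + E / (real N * p * l)"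
    by (simp add: add_divide_distrib)
  have N0: "0 \<le> 1 / (real N * p * l)" using N p l0 by simp
  have "\<bar>a - d\<bar> \<le> x + (u + w)"
    if "a = m + e" "0 \<le> x" "e \<le> u + w" "0 \<le> e" "m \<le> d" "d - x \<le> m" for a d x u w m e :: real
    using that by linarith
  from this[OF T N0 E1 E2 M2] show ?thesis unfolding l_def by simp
qed

section \<open>Limits\<close>

text \<open>Convergence of \<open>n * x\<close> together with \<open>x\<close> tending to 0 forces
  \<open>n * x^2\<close> to 0, so \<open>one_minus_power_exp\<close> permits replacing the power by
  \<open>exp (- (n * x))\<close>.\<close>

lemma tendsto_one_minus_power_exp:
  fixes x :: "nat \<Rightarrow> real"
  assumes "(\<lambda>N. real (n N) * x N) \<longlonglongrightarrow> y" "x \<longlonglongrightarrow> 0" "\<And>N. 0 \<le> x N"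
  shows "(\<lambda>N. (1 - x N) ^ n N) \<longlonglongrightarrow> exp (- y)"
proof -
  have "(\<lambda>N. real (n N) * x N * x N) \<longlonglongrightarrow> y * 0"
    by (intro tendsto_mult assms)
  then have "(\<lambda>N. real (n N) * (x N)\<^sup>2) \<longlonglongrightarrow> 0" by (simp add: power2_eq_square mult.assoc)
  moreover have "\<forall>\<^sub>F N in sequentially. x N < 1" using order_tendstoD(2)[OF assms(2)] by simp
  then have "\<forall>\<^sub>F N in sequentially. norm ((1 - x N) ^ n N - exp (- (real (n N) * x N))) \<le> real (n N) * (x N)\<^sup>2"
    by (rule eventually_mono) (use assms(3) one_minus_power_exp in simp)
  ultimately have "(\<lambda>N. (1 - x N) ^ n N - exp (- (real (n N) * x N))) \<longlonglongrightarrow> 0"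
    by (rule Lim_null_comparison[rotated])
  then have "(\<lambda>N. ((1 - x N) ^ n N - exp (- (real (n N) * x N))) + exp (- (real (n N) * x N))) \<longlonglongrightarrow> 0 + exp (- y)"
    by (intro tendsto_add tendsto_exp tendsto_minus assms)
  then show ?thesis by simp
qed

section \<open>Limits at fixed activity probability\<close>

lemma rho_le_1: "rho M L t \<le> 1"
proof -
  have "(M - t) choose L \<le> M choose L" by (intro binomial_right_mono) simp
  then show ?thesis unfolding rho_def divide_le_eq_1 of_nat_le_iff of_nat_0_less_iff of_nat_eq_0_iff
    by (simp only: neq0_conv[symmetric]) blast
qed

text \<open>For fixed \<open>p\<close> the row size \<open>L\<close> is constant and the number of
  tests grows in proportion to \<open>N\<close>. The ratio uses \<open>N - 1\<close> because one
  item is singled out.\<close>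

locale proportional_tests =
  fixes M :: "nat \<Rightarrow> nat" and L :: nat and p k :: real
  assumes M_top: "filterlim (\<lambda>N. real (M N)) at_top sequentially"
    and ratio: "(\<lambda>N. real (N - 1) / real (M N)) \<longlonglongrightarrow> k"
    and p01: "0 \<le> p" "p \<le> 1"
begin

lemma inverse_M: "(\<lambda>N. c / real (M N)) \<longlonglongrightarrow> 0"
  by (rule tendsto_divide_0[OF tendsto_const filterlim_at_top_imp_at_infinity[OF M_top]])

lemma eventually_M: "\<forall>\<^sub>F N in sequentially. c < M N"
  using M_top[unfolded filterlim_at_top_dense, rule_format, of "real c"]
  by (rule eventually_mono) simp

text \<open>Each further test adds \<open>L\<close> in the limit: by \<open>rho_Suc\<close> the
  increment is \<open>rho * L / (1 - t / M)\<close>, and \<open>rho\<close> itself tends to 1 by the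
  induction hypothesis.\<close>

lemma rho_limit: "(\<lambda>N. real (M N) * (1 - rho (M N) L t)) \<longlonglongrightarrow> real t * real L"
proof (induction t)
  case 0
  have "\<forall>\<^sub>F N in sequentially. real (M N) * (1 - rho (M N) L 0) = real 0 * real L"
    using eventually_M[of L] by (rule eventually_mono) (simp add: rho_0)
  then show ?case by (rule tendsto_eventually)
next
  case (Suc t)
  have "(\<lambda>N. 1 - real (M N) * (1 - rho (M N) L t) * (1 / real (M N))) \<longlonglongrightarrow> 1 - real t * real L * 0"
    by (intro tendsto_diff tendsto_const tendsto_mult Suc inverse_M)
  moreover have "\<forall>\<^sub>F N in sequentially. 1 - real (M N) * (1 - rho (M N) L t) * (1 / real (M N)) = rho (M N) L t"
    using eventually_M[of 0] by (rule eventually_mono) simp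
  ultimately have r: "(\<lambda>N. rho (M N) L t) \<longlonglongrightarrow> 1"
    by (simp add: Lim_transform_eventually)
  have "(\<lambda>N. real (M N) * (1 - rho (M N) L t) + rho (M N) L t * (real L / (1 - real t / real (M N))))
    \<longlonglongrightarrow> real t * real L + 1 * (real L / (1 - 0))"
    by (intro tendsto_add Suc tendsto_mult r tendsto_divide tendsto_const tendsto_diff inverse_M) simp
  moreover have "\<forall>\<^sub>F N in sequentially. real (M N) * (1 - rho (M N) L t) + rho (M N) L t * (real L / (1 - real t / real (M N)))
     = real (M N) * (1 - rho (M N) L (Suc t))"
    using eventually_conj[OF eventually_M[of t] eventually_M[of L]]
  proof (rule eventually_mono)
    fix N assume "t < M N \<and> L < M N"
    then have M: "t < M N" "L < M N" by auto
    have "real L / (1 - real t / real (M N)) = real (M N) * (real L / (real (M N) - real t))"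
      using M by (simp add: field_simps)
    then show "real (M N) * (1 - rho (M N) L t) + rho (M N) L t * (real L / (1 - real t / real (M N)))
     = real (M N) * (1 - rho (M N) L (Suc t))"
      using M by (simp add: rho_Suc algebra_simps)
  qed
  ultimately have "(\<lambda>N. real (M N) * (1 - rho (M N) L (Suc t))) \<longlonglongrightarrow> real t * real L + 1 * (real L / (1 - 0))"
    by (rule Lim_transform_eventually)
  then show ?case by (simp add: algebra_simps)
qed

text \<open>Each of the \<open>N - 1\<close> factors is \<open>1 - x\<close> with
  \<open>M * x\<close> convergent. The choice \<open>c = 0\<close> yields \<open>avoid_prob\<close>,
  and \<open>c = t * L * (1 - v) ^ (L - 1)\<close> yields \<open>unresolved_prob\<close>.\<close>

lemma thinned_power_limit:
  assumes "0 \<le> c"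
  shows "(\<lambda>N. (p * rho (M N) L t + (1 - p) * (1 - c / real (M N))) ^ (N - 1))
    \<longlonglongrightarrow> exp (- (k * (p * (real t * real L) + (1 - p) * c)))"
proof -
  define x where "x N = p * (1 - rho (M N) L t) + (1 - p) * (c / real (M N))" for N
  have Mx: "(\<lambda>N. p * (real (M N) * (1 - rho (M N) L t)) + (1 - p) * c) \<longlonglongrightarrow> p * (real t * real L) + (1 - p) * c"
    by (intro tendsto_intros rho_limit)
  have eq: "\<forall>\<^sub>F N in sequentially. x N = (p * (real (M N) * (1 - rho (M N) L t)) + (1 - p) * c) * (1 / real (M N))"
    using eventually_M[of 0] by (rule eventually_mono) (simp add: x_def field_simps)
  have "(\<lambda>N. (1 - x N) ^ (N - 1)) \<longlonglongrightarrow> exp (- (k * (p * (real t * real L) + (1 - p) * c)))"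
  proof (rule tendsto_one_minus_power_exp)
    have "(\<lambda>N. real (N - 1) / real (M N) * (p * (real (M N) * (1 - rho (M N) L t)) + (1 - p) * c))
      \<longlonglongrightarrow> k * (p * (real t * real L) + (1 - p) * c)"
      by (intro tendsto_mult ratio Mx)
    moreover have "\<forall>\<^sub>F N in sequentially. real (N - 1) / real (M N) * (p * (real (M N) * (1 - rho (M N) L t)) + (1 - p) * c)
       = real (N - 1) * x N"
      using eq by (rule eventually_mono) simp
    ultimately show "(\<lambda>N. real (N - 1) * x N) \<longlonglongrightarrow> k * (p * (real t * real L) + (1 - p) * c)"
      by (rule Lim_transform_eventually)
    have "(\<lambda>N. (p * (real (M N) * (1 - rho (M N) L t)) + (1 - p) * c) * (1 / real (M N)))
      \<longlonglongrightarrow> (p * (real t * real L) + (1 - p) * c) * 0"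
      by (intro tendsto_mult Mx inverse_M)
    then show "x \<longlonglongrightarrow> 0"
      using eq by (simp add: Lim_transform_eventually[OF _ eventually_mono[OF eq sym]])
    show "0 \<le> x N" for N unfolding x_def using p01 assms rho_le_1 by simp
  qed
  moreover have "1 - x N = p * rho (M N) L t + (1 - p) * (1 - c / real (M N))" for N
    unfolding x_def by (simp add: algebra_simps)
  ultimately show ?thesis by simp
qed

lemma avoid_limit:
  "(\<lambda>N. avoid_prob (M N) L p (N - 1) t) \<longlonglongrightarrow> exp (- (k * p * real L)) ^ t"
  using thinned_power_limit[of 0 t]
  by (simp add: avoid_prob_def exp_of_nat_mult[symmetric] algebra_simps)

lemma unresolved_limit:
  assumes "v \<le> 1"
  shows "(\<lambda>N. unresolved_prob (M N) L p v (N - 1) t)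
    \<longlonglongrightarrow> exp (- (k * (p * (real t * real L) + (1 - p) * (real t * real L * (1 - v) ^ (L - 1)))))"
  unfolding unresolved_prob_def using assms by (intro thinned_power_limit) auto

text \<open>With this \<open>v\<close> the probabilities for one and two negative tests tend to
  \<open>v\<close> and \<open>v^2\<close>, so the second moment tends to
  \<open>v^2 - 2 * v^2 + v^2 = 0\<close>: the fraction of positive tests concentrates. The prefactor
  stays bounded because \<open>(N - 1) / M\<close> converges.\<close>

lemma unresolved_err_limit:
  assumes "v = exp (- (k * p * real L))"
  shows "(\<lambda>N. unresolved_err (M N) L p v (N - 1)) \<longlonglongrightarrow> 0"
proof -
  have D: "(\<lambda>N. (real (M N) - c) / real (M N)) \<longlonglongrightarrow> 1" for c
  proof -
    have "(\<lambda>N. 1 - c / real (M N)) \<longlonglongrightarrow> 1 - 0" by (intro tendsto_intros inverse_M)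
    moreover have "\<forall>\<^sub>F N in sequentially. 1 - c / real (M N) = (real (M N) - c) / real (M N)"
      using eventually_M[of 0] by (rule eventually_mono) (simp add: diff_divide_distrib)
    ultimately show ?thesis by (simp add: Lim_transform_eventually)
  qed
  have D2: "(\<lambda>N. (real (M N) - real L - 1) / real (M N)) \<longlonglongrightarrow> 1"
    using D[of "real L + 1"] by (simp add: diff_diff_eq)
  have "filterlim (\<lambda>N. real (M N) - real L) at_top sequentially"
    using filterlim_tendsto_add_at_top[OF tendsto_const M_top, of "- real L"] by simp
  then have 3: "(\<lambda>N. 3 * real L / (real (M N) - real L)) \<longlonglongrightarrow> 0"
    by (intro tendsto_divide_0[OF tendsto_const] filterlim_at_top_imp_at_infinity)
  have a: "(\<lambda>N. avoid_prob (M N) L p (N - 1) 1) \<longlonglongrightarrow> v"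
    "(\<lambda>N. avoid_prob (M N) L p (N - 1) 2) \<longlonglongrightarrow> v\<^sup>2"
    using avoid_limit[of 1] avoid_limit[of 2] assms by auto
  have am: "(\<lambda>N. avoid_prob (M N) L p (N - 1) 1 / real (M N)) \<longlonglongrightarrow> 0"
    using tendsto_mult[OF a(1) inverse_M[of 1]] by simp
  have "(\<lambda>N. unresolved_err (M N) L p v (N - 1)) \<longlonglongrightarrow> k * real L ^ 3 * (0
     + sqrt (v\<^sup>2 - 2 * v * 1 * v + 1 * 0 + 1 * 1 * v\<^sup>2 + 0))"
    unfolding unresolved_err_def
    by (intro tendsto_mult tendsto_add tendsto_diff tendsto_real_sqrt tendsto_const ratio 3 D D2 a am inverse_M)
  then show ?thesis by (simp add: power2_eq_square)
qed

end

text \<open>The number of tests per item converges, \<open>missed_zero\<close> is an explicit finite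
  sum of convergent terms, and \<open>missed_one\<close> is within a vanishing error of another such
  sum, uniformly in \<open>i\<close>.\<close>

lemma convergent_avg_cost:
  assumes p: "0 < p" "p \<le> 1/2"
  shows "convergent (\<lambda>N. avg_cost N p)"
proof -
  define l where "l = \<bar>ln p\<bar>"
  define L where "L = Lbar p"
  define M where "M N = Mbar N p" for N
  \<comment> \<open>The limiting number of tests per item.\<close>
  define c where "c = p * l / (ln 2)\<^sup>2"
  note Lb = Lbar_bounds[OF p, folded l_def L_def]
  have l0: "0 < l" using Lb(1) ln2_ge_two_thirds by linarith
  have c0: "0 < c" unfolding c_def using p l0 by simp
  have Mfl: "real (M N) = real_of_int \<lfloor>c * real N\<rfloor>" for N
  proof -
    have "0 \<le> c * real N" using c0 by simp
    then show ?thesis unfolding M_def Mbar_def c_def l_def by (simp add: mult_ac)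
  qed
  have Mb: "c * real N - 1 \<le> real (M N)" "real (M N) \<le> c * real N" for N
    unfolding Mfl by linarith+
  have MN: "(\<lambda>N. real (M N) / real N) \<longlonglongrightarrow> c"
  proof (rule real_tendsto_sandwich)
    show "(\<lambda>N. c - 1 / real N) \<longlonglongrightarrow> c"
      using tendsto_diff[OF tendsto_const[of c] lim_1_over_n] by simp
    show "(\<lambda>N. c) \<longlonglongrightarrow> c" by simp
    show "\<forall>\<^sub>F N in sequentially. c - 1 / real N \<le> real (M N) / real N"
      using eventually_gt_at_top[of 0]
    proof (rule eventually_mono)
      fix N :: nat assume "0 < N"
      then show "c - 1 / real N \<le> real (M N) / real N"
        using divide_right_mono[OF Mb(1)[of N], of "real N"] by (simp add: diff_divide_distrib)
    qed
    show "\<forall>\<^sub>F N in sequentially. real (M N) / real N \<le> c"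
      using eventually_gt_at_top[of 0]
    proof (rule eventually_mono)
      fix N :: nat assume "0 < N"
      then show "real (M N) / real N \<le> c" using Mb(2)[of N] by (simp add: field_simps)
    qed
  qed
  have Mtop: "filterlim (\<lambda>N. real (M N)) at_top sequentially"
  proof (rule filterlim_at_top_mono)
    show "filterlim (\<lambda>N. - 1 + c * real N) at_top sequentially"
      by (intro filterlim_tendsto_add_at_top[OF tendsto_const] filterlim_tendsto_pos_mult_at_top[OF tendsto_const c0] filterlim_real_sequentially)
    show "\<forall>\<^sub>F N in sequentially. - 1 + c * real N \<le> real (M N)"
      using Mb(1) by (intro always_eventually) (simp add: algebra_simps)
  qed
  have ratio: "(\<lambda>N. real (N - 1) / real (M N)) \<longlonglongrightarrow> 1 / c"
  proof -
    have "(\<lambda>N. (1 - 1 / real N) / (real (M N) / real N)) \<longlonglongrightarrow> (1 - 0) / c"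
      using c0 by (intro tendsto_intros MN lim_1_over_n) auto
    moreover have "\<forall>\<^sub>F N in sequentially. (1 - 1 / real N) / (real (M N) / real N) = real (N - 1) / real (M N)"
      using eventually_gt_at_top[of 0]
    proof (rule eventually_mono)
      fix N :: nat assume "0 < N"
      moreover from this have "1 - 1 / real N = real (N - 1) / real N"
        by (simp add: diff_divide_distrib of_nat_diff)
      ultimately show "(1 - 1 / real N) / (real (M N) / real N) = real (N - 1) / real (M N)" by simp
    qed
    ultimately show ?thesis by (simp add: Lim_transform_eventually)
  qed
  interpret proportional_tests M L p "1 / c"
    using Mtop ratio p by unfold_locales auto
  \<comment> \<open>The limiting probability that a given test is negative, in the form required by
    \<open>unresolved_err_limit\<close>.\<close>
  define v where "v = exp (- (1 / c * p * real L))"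
  have v: "0 \<le> v" "v \<le> 1" unfolding v_def using c0 p by auto
  define z where "z N = (\<Sum>t\<le>L. real (L choose t) * ((-1) ^ t * avoid_prob (M N) L p (N - 1) t))" for N
  define u where "u N = (\<Sum>t\<le>L. real (L choose t) * ((-1) ^ t * unresolved_prob (M N) L p v (N - 1) t))" for N
  define z0 where "z0 = (\<Sum>t\<le>L. real (L choose t) * ((-1) ^ t * exp (- (1 / c * p * real L)) ^ t))"
  define u0 where "u0 = (\<Sum>t\<le>L. real (L choose t) * ((-1) ^ t *
    exp (- (1 / c * (p * (real t * real L) + (1 - p) * (real t * real L * (1 - v) ^ (L - 1)))))))"
  have z0: "z \<longlonglongrightarrow> z0"
    unfolding z_def z0_def by (intro tendsto_sum tendsto_mult tendsto_const avoid_limit)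
  have u0: "u \<longlonglongrightarrow> u0"
    unfolding u_def u0_def by (intro tendsto_sum tendsto_mult tendsto_const unresolved_limit[OF v(2)])
  \<comment> \<open>Since \<open>missed_one\<close> is only estimated, it is averaged over the items
    before passing to the limit.\<close>
  define m where "m N = (\<Sum>i<N. pooling.missed_one (M N) L p N i) / real N" for N
  have large: "\<forall>\<^sub>F N in sequentially. 0 < N \<and> 2 * L < M N \<and> L * L \<le> M N"
    using eventually_conj[OF eventually_gt_at_top[of 0] eventually_conj[OF eventually_M[of "2 * L"] eventually_M[of "L * L"]]]
    by (rule eventually_mono) simp
  have "(\<lambda>N. m N - u N) \<longlonglongrightarrow> 0"
  proof (rule Lim_null_comparison)
    show "(\<lambda>N. 2 ^ L * unresolved_err (M N) L p v (N - 1)) \<longlonglongrightarrow> 0"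
      using tendsto_mult[OF tendsto_const unresolved_err_limit[OF v_def], of "2 ^ L"] by simp
    show "\<forall>\<^sub>F N in sequentially. norm (m N - u N) \<le> 2 ^ L * unresolved_err (M N) L p v (N - 1)"
      using large
    proof (rule eventually_mono)
      fix N assume a: "0 < N \<and> 2 * L < M N \<and> L * L \<le> M N"
      then interpret P: pooling "M N" L p using p by unfold_locales auto
      let ?e = "2 ^ L * unresolved_err (M N) L p v (N - 1)"
      have le: "\<bar>P.missed_one N i - u N\<bar> \<le> ?e" if "i < N" for i
        using P.missed_one_approx[of i N v] that a v Lb(2) unfolding u_def by simp
      have "m N - u N = (\<Sum>i<N. P.missed_one N i - u N) / real N"
        unfolding m_def using a by (simp add: sum_subtractf diff_divide_distrib)
      then have "norm (m N - u N) = \<bar>\<Sum>i<N. P.missed_one N i - u N\<bar> / real N" by simp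
      also have "\<dots> \<le> (\<Sum>i<N. ?e) / real N"
        by (intro divide_right_mono order.trans[OF sum_abs] sum_mono le) auto
      also have "\<dots> = ?e" using a by simp
      finally show "norm (m N - u N) \<le> ?e" .
    qed
  qed
  from tendsto_add[OF this u0] have m0: "m \<longlonglongrightarrow> u0" by simp
  have "(\<lambda>N. (real (M N) / real N + ((1 - p) * z N + p * m N)) / (p * l)) \<longlonglongrightarrow> (c + ((1 - p) * z0 + p * u0)) / (p * l)"
    using p l0 by (intro tendsto_intros MN z0 m0) auto
  moreover have "\<forall>\<^sub>F N in sequentially. (real (M N) / real N + ((1 - p) * z N + p * m N)) / (p * l) = avg_cost N p"
    using large
  proof (rule eventually_mono)
    fix N assume a: "0 < N \<and> 2 * L < M N \<and> L * L \<le> M N"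
    then interpret P: pooling "M N" L p using p by unfold_locales auto
    have zi: "P.missed_zero N i = z N" if "i < N" for i
      unfolding z_def by (rule P.missed_zero_eq[OF that])
    have "avg_cost N p = (real (M N) + (\<Sum>i<N. (1 - p) * P.missed_zero N i + p * P.missed_one N i)) / (real N * p * l)"
      using avg_cost_eq[of p N] P.L_le_M p unfolding M_def L_def l_def by simp
    also have "(\<Sum>i<N. (1 - p) * P.missed_zero N i + p * P.missed_one N i) = real N * ((1 - p) * z N + p * m N)"
    proof -
      have "(\<Sum>i<N. (1 - p) * P.missed_zero N i) = real N * ((1 - p) * z N)" by (simp add: zi)
      moreover have "(\<Sum>i<N. P.missed_one N i) = real N * m N" unfolding m_def using a by simp
      ultimately show ?thesis
        by (simp add: sum.distrib sum_distrib_left[symmetric] distrib_left mult.left_commute)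
    qed
    also have "(real (M N) + real N * ((1 - p) * z N + p * m N)) / (real N * p * l)
      = (real (M N) / real N + ((1 - p) * z N + p * m N)) / (p * l)"
      using a p l0 by (simp add: field_simps)
    finally show "(real (M N) / real N + ((1 - p) * z N + p * m N)) / (p * l) = avg_cost N p" by simp
  qed
  ultimately show ?thesis
    by (intro convergentI[OF Lim_transform_eventually])
qed

text \<open>At fixed \<open>p\<close> the first two errors of \<open>avg_cost_approx\<close> vanish
  as \<open>N\<close> grows. The inner limit \<open>g p\<close> is thus within
  \<open>7 / |ln p|\<close> of the claimed value, and this tends to 0 with \<open>p\<close>.\<close>

lemma avg_cost_limit_zero_exponent:
  "lim_beta 0 avg_cost (1 / (ln 2)\<^sup>2)"
proof -
  define g where "g p = lim (\<lambda>N. avg_cost N p)" for p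
  have g: "(\<lambda>N. avg_cost N p) \<longlonglongrightarrow> g p" if "0 < p" "p \<le> 1/2" for p
    unfolding g_def using convergent_avg_cost[OF that] by (simp add: convergent_LIMSEQ_iff)
  have gb: "norm (g p - 1 / (ln 2)\<^sup>2) \<le> 7 / \<bar>ln p\<bar>" if p: "0 < p" "p \<le> 1/2" for p
  proof (rule tendsto_le[OF sequentially_bot])
    show "(\<lambda>N. norm (avg_cost N p - 1 / (ln 2)\<^sup>2)) \<longlonglongrightarrow> norm (g p - 1 / (ln 2)\<^sup>2)"
      by (intro tendsto_intros g p)
    have "(\<lambda>N. (1 / (p * \<bar>ln p\<bar>)) * (1 / real N) + (32 * \<bar>ln p\<bar> / p\<^sup>2) * (1 / real N) + 7 / \<bar>ln p\<bar>)
      \<longlonglongrightarrow> (1 / (p * \<bar>ln p\<bar>)) * 0 + (32 * \<bar>ln p\<bar> / p\<^sup>2) * 0 + 7 / \<bar>ln p\<bar>"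
      by (intro tendsto_add tendsto_mult tendsto_const lim_1_over_n)
    then show "(\<lambda>N. 1 / (real N * p * \<bar>ln p\<bar>) + 32 * \<bar>ln p\<bar> / (real N * p\<^sup>2) + 7 / \<bar>ln p\<bar>) \<longlonglongrightarrow> 7 / \<bar>ln p\<bar>"
      by (simp add: mult_ac)
    have "\<forall>\<^sub>F N in sequentially. 2 / p \<le> real N"
      using filterlim_real_sequentially unfolding filterlim_at_top by blast
    then show "\<forall>\<^sub>F N in sequentially. norm (avg_cost N p - 1 / (ln 2)\<^sup>2)
       \<le> 1 / (real N * p * \<bar>ln p\<bar>) + 32 * \<bar>ln p\<bar> / (real N * p\<^sup>2) + 7 / \<bar>ln p\<bar>"
      by (rule eventually_mono) (use avg_cost_approx[OF p] p in \<open>simp add: field_simps\<close>)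
  qed
  have ev: "\<forall>\<^sub>F p in at_right 0. 0 < p \<and> p \<le> (1/2 :: real)"
    unfolding eventually_at_right_field by (intro exI[of _ "1/2"]) auto
  have "filterlim (\<lambda>p :: real. \<bar>ln p\<bar>) at_infinity (at_right 0)"
    using filterlim_compose[OF filterlim_norm_at_top filterlim_at_bot_imp_at_infinity[OF ln_at_0]]
    by (intro filterlim_at_top_imp_at_infinity) simp
  then have "((\<lambda>p. 7 / \<bar>ln p\<bar>) \<longlongrightarrow> 0) (at_right (0::real))"
    by (intro tendsto_divide_0[OF tendsto_const])
  then have "((\<lambda>p. g p - 1 / (ln 2)\<^sup>2) \<longlongrightarrow> 0) (at_right 0)"
    by (rule Lim_null_comparison[rotated]) (use ev gb in \<open>auto elim!: eventually_mono\<close>)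
  then have "(g \<longlongrightarrow> 1 / (ln 2)\<^sup>2) (at_right 0)" by (rule LIM_zero_cancel)
  moreover have "\<forall>\<^sub>F p in at_right 0. (\<lambda>N. avg_cost N p) \<longlonglongrightarrow> g p"
    using ev by (rule eventually_mono) (use g in auto)
  ultimately show ?thesis unfolding lim_beta_def by auto
qed

text \<open>Under \<open>p = N powr (- \<beta>)\<close> the decisive error of
  \<open>avg_cost_approx\<close> is a multiple of \<open>ln N / N powr (1 - 2 * \<beta>)\<close>,
  which tends to 0 because \<open>\<beta> < 1/2\<close>.\<close>

lemma avg_cost_limit_positive_exponent:
  assumes b: "0 < \<beta>" "\<beta> < 1/2"
  shows "lim_beta \<beta> avg_cost (1 / (ln 2)\<^sup>2)"
proof -
  define P where "P N = real N powr (- \<beta>)" for N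
  have lnt: "filterlim (\<lambda>N. ln (real N)) at_top sequentially"
    by (rule filterlim_compose[OF ln_at_top filterlim_real_sequentially])
  have top: "filterlim (\<lambda>N. real N powr s) at_top sequentially" if "0 < s" for s
  proof (rule filterlim_at_top_mono)
    show "filterlim (\<lambda>N. exp (s * ln (real N))) at_top sequentially"
      by (intro filterlim_compose[OF exp_at_top] filterlim_tendsto_pos_mult_at_top[OF tendsto_const that lnt])
    show "\<forall>\<^sub>F N in sequentially. exp (s * ln (real N)) \<le> real N powr s"
      using eventually_gt_at_top[of 0] by (rule eventually_mono) (simp add: powr_def)
  qed
  have P0: "P \<longlonglongrightarrow> 0"
    unfolding P_def using b by (intro tendsto_neg_powr filterlim_real_sequentially) auto
  have lnP: "\<bar>ln (P N)\<bar> = \<beta> * ln (real N)" if "0 < N" for N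
    unfolding P_def using that b by (simp add: ln_powr abs_mult)
  have NP: "real N * P N = real N powr (1 - \<beta>)" "real N * (P N)\<^sup>2 = real N powr (1 - 2 * \<beta>)" if "0 < N" for N
    unfolding P_def using that by (simp_all add: powr_diff powr_minus power2_eq_square powr_add[symmetric] field_simps)
  have t1: "(\<lambda>N. 1 / (real N powr (1 - \<beta>) * (\<beta> * ln (real N)))) \<longlonglongrightarrow> 0"
    using b by (intro tendsto_divide_0[OF tendsto_const] filterlim_at_top_imp_at_infinity
       filterlim_at_top_mult_at_top top filterlim_tendsto_pos_mult_at_top[OF tendsto_const _ lnt]) auto
  have t2: "(\<lambda>N. 32 * \<beta> * (ln (real N) / real N powr (1 - 2 * \<beta>))) \<longlonglongrightarrow> 0"
    using tendsto_mult[OF tendsto_const lim_ln_over_power[of "1 - 2 * \<beta>"], of "32 * \<beta>"] b by simp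
  have t3: "(\<lambda>N. 7 / (\<beta> * ln (real N))) \<longlonglongrightarrow> 0"
    using b by (intro tendsto_divide_0[OF tendsto_const] filterlim_at_top_imp_at_infinity
       filterlim_tendsto_pos_mult_at_top[OF tendsto_const _ lnt]) auto
  have "(\<lambda>N. avg_cost N (P N) - 1 / (ln 2)\<^sup>2) \<longlonglongrightarrow> 0"
  proof (rule Lim_null_comparison)
    show "(\<lambda>N. 1 / (real N powr (1 - \<beta>) * (\<beta> * ln (real N)))
       + 32 * \<beta> * (ln (real N) / real N powr (1 - 2 * \<beta>)) + 7 / (\<beta> * ln (real N))) \<longlonglongrightarrow> 0"
      using tendsto_add[OF tendsto_add[OF t1 t2] t3] by simp
    have "\<forall>\<^sub>F N in sequentially. 2 \<le> real N powr (1 - \<beta>)"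
      using top[of "1 - \<beta>"] b unfolding filterlim_at_top by auto
    moreover have "\<forall>\<^sub>F N in sequentially. P N < 1/2" using order_tendstoD(2)[OF P0, of "1/2"] by simp
    moreover note eventually_gt_at_top[of "0::nat"]
    ultimately show "\<forall>\<^sub>F N in sequentially. norm (avg_cost N (P N) - 1 / (ln 2)\<^sup>2)
      \<le> 1 / (real N powr (1 - \<beta>) * (\<beta> * ln (real N)))
       + 32 * \<beta> * (ln (real N) / real N powr (1 - 2 * \<beta>)) + 7 / (\<beta> * ln (real N))"
    proof eventually_elim
      case (elim N)
      have "0 < P N" unfolding P_def using elim by simp
      then have "\<bar>avg_cost N (P N) - 1 / (ln 2)\<^sup>2\<bar> \<le> 1 / (real N * P N * \<bar>ln (P N)\<bar>)
         + 32 * \<bar>ln (P N)\<bar> / (real N * (P N)\<^sup>2) + 7 / \<bar>ln (P N)\<bar>"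
        using elim NP(1)[of N] by (intro avg_cost_approx) auto
      then show ?case
        unfolding lnP[OF elim(3)] NP[OF elim(3)] by simp
    qed
  qed
  then have "(\<lambda>N. avg_cost N (P N)) \<longlonglongrightarrow> 1 / (ln 2)\<^sup>2" by (rule LIM_zero_cancel)
  then show ?thesis unfolding lim_beta_def P_def using b by simp
qed

theorem theorem4:
  fixes \<beta> :: real
  assumes "0 \<le> \<beta>" and "\<beta> < 1/2"
  shows "lim_beta \<beta> avg_cost (1 / (ln 2)\<^sup>2)"
  using assms avg_cost_limit_zero_exponent avg_cost_limit_positive_exponent
  by (cases "\<beta> = 0") auto

end
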